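(* Let $\{w^k=(x^k,y^k,z^k)\}$ be a sequence generated by the algorithm imsPADMM (described in the context) applied to the problem $\min\{p(x)+f(x)+q(y)+g(y)\mid \mathcal A^*x+\mathcal B^*y=c\}$. Suppose that the solution set $\overline{\mathcal W}$ of the KKT system of this problem is nonempty, that $$\Sigma_f+\mathcal S+\sigma\mathcal A\mathcal A^*\succ 0\quad\text{and}\quad \Sigma_g+\mathcal T+\sigma\mathcal B\mathcal B^*\succ 0,$$ and that the (convergent) sequence $\{w^k\}$ converges to the limit $\bar w=(\bar x,\bar y,\bar z)$. Then there exists a constant $\omega>0$ such that $$\min_{1\le i\le k}\{D(w^{i+1})\}\le\frac{\omega}{k}\quad\text{for all }k\ge1,\qquad\text{and}\qquad \lim_{k\to\infty}\Bigl\{k\cdot\min_{1\le i\le k}\{D(w^{i+1})\}\Bigr\}=0,$$ where for $w=(x,y,z)\in\mathcal W$, $$D(w):=\operatorname{dist}^2\bigl(0,\partial p(x)+\nabla f(x)+\mathcal Az\bigr)+\operatorname{dist}^2\bigl(0,\partial q(y)+\nabla g(y)+\mathcal Bz\bigr)+\|\mathcal A^*x+\mathcal B^*y-c\|^2 .$$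
   Context: Problem. Let $m,n\ge1$ be integers, let $\mathcal Z,\mathcal X_1,\dots,\mathcal X_m,\mathcal Y_1,\dots,\mathcal Y_n$ be finite dimensional real Euclidean spaces, $\mathcal X=\mathcal X_1\times\cdots\times\mathcal X_m$, $\mathcal Y=\mathcal Y_1\times\cdots\times\mathcal Y_n$, $\mathcal W=\mathcal X\times\mathcal Y\times\mathcal Z$. Let $p_1:\mathcal X_1\to(-\infty,\infty]$ and $q_1:\mathcal Y_1\to(-\infty,\infty]$ be closed proper convex functions, $p(x):=p_1(x_1)$, $q(y):=q_1(y_1)$; let $f:\mathcal X\to\mathbb R$ and $g:\mathcal Y\to\mathbb R$ be continuously differentiable convex functions with Lipschitz continuous gradients; let $\mathcal A:\mathcal Z\to\mathcal X$ and $\mathcal B:\mathcal Z\to\mathcal Y$ be linear with adjoints $\mathcal A^*,\mathcal B^*$, and $c\in\mathcal Z$. The problem is $\min_{x,y}\{p(x)+f(x)+q(y)+g(y)\mid \mathcal A^*x+\mathcal B^*y=c\}$. Its KKT solution set $\overline{\mathcal W}$ is the set of $(x,y,z)\in\mathcal W$ with $0\in\partial p(x)+\nabla f(x)+\mathcal A z$, $0\in\partial q(y)+\nabla g(y)+\mathcal B z$, $\mathcal A^*x+\mathcal B^*y=c$. Notation. $\operatorname{dist}(u,U):=\inf_{u'\in U}\|u-u'\|$ (equal to $+\infty$ if $U=\emptyset$). For a self-adjoint positive semidefinite operator $\mathcal H$, $\|u\|_{\mathcal H}^2:=\langle u,\mathcal H u\rangle$ and $\mathcal H^{1/2}$ is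 its positive semidefinite square root. Majorization and minorization operators. $\widehat\Sigma_f,\Sigma_f$ on $\mathcal X$ and $\widehat\Sigma_g,\Sigma_g$ on $\mathcal Y$ are fixed self-adjoint positive semidefinite linear operators with $\Sigma_f\preceq\widehat\Sigma_f$, $\Sigma_g\preceq\widehat\Sigma_g$ such that for all $x,x'\in\mathcal X$, $\tfrac12\|x-x'\|^2_{\Sigma_f}\le f(x)-f(x')-\langle\nabla f(x'),x-x'\rangle\le\tfrac12\|x-x'\|^2_{\widehat\Sigma_f}$, and for all $y,y'\in\mathcal Y$, $\tfrac12\|y-y'\|^2_{\Sigma_g}\le g(y)-g(y')-\langle\nabla g(y'),y-y'\rangle\le\tfrac12\|y-y'\|^2_{\widehat\Sigma_g}$. Algorithm imsPADMM. Parameters: $\sigma>0$; $\tau\in(0,(1+\sqrt5)/2)$; a summable sequence $\{\varepsilon_k\}_{k\ge0}$ of nonnegative numbers; self-adjoint positive semidefinite linear operators $\mathcal S:\mathcal X\to\mathcal X$, $\mathcal T:\mathcal Y\to\mathcal Y$ such that $\mathcal M:=\widehat\Sigma_f+\mathcal S+\sigma\mathcal A\mathcal A^*\succ0$ and $\mathcal N:=\widehat\Sigma_g+\mathcal T+\sigma\mathcal B\mathcal B^*\succ0$; an initial point $(x^0,y^0,z^0)\in\operatorname{dom}p\times\operatorname{dom}q\times\mathcal Z$. A sequence is generated by imsPADMM if for every $k\ge0$: (Step 1) $x^{k+1}\in\mathcal X$ and $d_x^k\in\partial\psi_k(x^{k+1})$ satisfy $\|\mathcal M^{-1/2}d_x^k\|\le\varepsilon_k$,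 where $\psi_k(x):=p(x)+\tfrac12\langle x,\mathcal Mx\rangle-\langle l_x^k,x\rangle$ and $-l_x^k:=\nabla f(x^k)+\mathcal Az^k-\mathcal Mx^k+\sigma\mathcal A(\mathcal A^*x^k+\mathcal B^*y^k-c)$; (Step 2) $y^{k+1}\in\mathcal Y$ and $d_y^k\in\partial\varphi_k(y^{k+1})$ satisfy $\|\mathcal N^{-1/2}d_y^k\|\le\varepsilon_k$, where $\varphi_k(y):=q(y)+\tfrac12\langle y,\mathcal Ny\rangle-\langle l_y^k,y\rangle$ and $-l_y^k:=\nabla g(y^k)+\mathcal Bz^k-\mathcal Ny^k+\sigma\mathcal B(\mathcal A^*x^{k+1}+\mathcal B^*y^k-c)$; (Step 3) $z^{k+1}:=z^k+\tau\sigma(\mathcal A^*x^{k+1}+\mathcal B^*y^{k+1}-c)$. *)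

theory Defs
  imports "HOL-Analysis.Analysis"
begin

text \<open>A finite product of Euclidean spaces, with the number of factors and all their dimensions
  arbitrary, is rendered as a Euclidean space together with the orthogonal family \<open>V 1, \<dots>, V m\<close> of
  subspaces formed by its factors. The factors may be trivial subspaces.\<close>

definition orthogonal_blocks :: "nat \<Rightarrow> (nat \<Rightarrow> 'a::euclidean_space set) \<Rightarrow> bool" where
  "orthogonal_blocks m V \<longleftrightarrow>
     (\<forall>i\<in>{1..m}. subspace (V i)) \<and>
     (\<forall>i\<in>{1..m}. \<forall>j\<in>{1..m}. i \<noteq> j \<longrightarrow> (\<forall>u\<in>V i. \<forall>v\<in>V j. orthogonal u v)) \<and>
     span (\<Union>i\<in>{1..m}. V i) = UNIV"

text \<open>The tuple \<open>(x\<^sub>1, \<dots>, x\<^sub>m)\<close> of a vector \<open>x\<close>; it is unique for orthogonal blocks.\<close>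

definition block_components ::
  "nat \<Rightarrow> (nat \<Rightarrow> 'a::euclidean_space set) \<Rightarrow> 'a \<Rightarrow> nat \<Rightarrow> 'a" where
  "block_components m V x = (THE u. u \<in> (\<Pi>\<^sub>E i\<in>{1..m}. V i) \<and> x = (\<Sum>i=1..m. u i))"

text \<open>Closed proper convex functions \<open>V \<rightarrow> (-\<infinity>, \<infinity>]\<close> on a subspace \<open>V\<close>, in terms of the epigraph;
  values outside \<open>V\<close> are irrelevant.\<close>

definition epigraph_on :: "'a::euclidean_space set \<Rightarrow> ('a \<Rightarrow> ereal) \<Rightarrow> ('a \<times> real) set" where
  "epigraph_on V f = {(x, r). x \<in> V \<and> f x \<le> ereal r}"

definition closed_proper_convex_on :: "'a::euclidean_space set \<Rightarrow> ('a \<Rightarrow> ereal) \<Rightarrow> bool" where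
  "closed_proper_convex_on V f \<longleftrightarrow>
     (\<forall>x\<in>V. f x \<noteq> -\<infinity>) \<and> (\<exists>x\<in>V. f x \<noteq> \<infinity>) \<and>
     convex (epigraph_on V f) \<and> closed (epigraph_on V f)"

definition effective_domain :: "('a \<Rightarrow> ereal) \<Rightarrow> 'a set" where
  "effective_domain f = {x. f x < \<infinity>}"

text \<open>For proper \<open>f\<close> this is empty at every \<open>x\<close> with \<open>f x = \<infinity>\<close>.\<close>

definition subdifferential :: "('a::euclidean_space \<Rightarrow> ereal) \<Rightarrow> 'a \<Rightarrow> 'a set" where
  "subdifferential f x = {v. \<forall>u. f x + ereal (v \<bullet> (u - x)) \<le> f u}"

definition psd_operator :: "('a::euclidean_space \<Rightarrow> 'a) \<Rightarrow> bool" where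
  "psd_operator H \<longleftrightarrow> linear H \<and> adjoint H = H \<and> (\<forall>u. 0 \<le> u \<bullet> H u)"

definition pd_operator :: "('a::euclidean_space \<Rightarrow> 'a) \<Rightarrow> bool" where
  "pd_operator H \<longleftrightarrow> linear H \<and> adjoint H = H \<and> (\<forall>u. u \<noteq> 0 \<longrightarrow> 0 < u \<bullet> H u)"

definition loewner_le :: "('a::euclidean_space \<Rightarrow> 'a) \<Rightarrow> ('a \<Rightarrow> 'a) \<Rightarrow> bool" where
  "loewner_le G H \<longleftrightarrow> psd_operator (\<lambda>u. H u - G u)"

definition psd_sqrt :: "('a::euclidean_space \<Rightarrow> 'a) \<Rightarrow> 'a \<Rightarrow> 'a" where
  "psd_sqrt H = (THE R. psd_operator R \<and> R \<circ> R = H)"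

text \<open>The squared seminorm \<open>\<parallel>u\<parallel>\<^sub>H\<^sup>2\<close>.\<close>

definition sqnorm_wrt :: "('a::euclidean_space \<Rightarrow> 'a) \<Rightarrow> 'a \<Rightarrow> real" where
  "sqnorm_wrt H u = u \<bullet> H u"

text \<open>Unlike \<^const>\<open>infdist\<close>, this is \<open>\<infinity>\<close> for the empty set.\<close>

definition edist_to :: "'a::euclidean_space \<Rightarrow> 'a set \<Rightarrow> ereal" where
  "edist_to u U = (INF u'\<in>U. ereal (norm (u - u')))"

text \<open>The set \<open>\<partial>p(x) + \<nabla>f(x) + A z\<close>, where \<open>gf\<close> is the gradient of \<open>f\<close>.\<close>

definition dual_residual_set ::
  "('a::euclidean_space \<Rightarrow> ereal) \<Rightarrow> ('a \<Rightarrow> 'a) \<Rightarrow> ('z \<Rightarrow> 'a) \<Rightarrow> 'a \<Rightarrow> 'z \<Rightarrow> 'a set" where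
  "dual_residual_set p gf A x z = (\<lambda>v. v + gf x + A z) ` subdifferential p x"

definition KKT_solutions ::
  "('x::euclidean_space \<Rightarrow> ereal) \<Rightarrow> ('y::euclidean_space \<Rightarrow> ereal) \<Rightarrow> ('x \<Rightarrow> 'x) \<Rightarrow> ('y \<Rightarrow> 'y) \<Rightarrow>
   ('z::euclidean_space \<Rightarrow> 'x) \<Rightarrow> ('z \<Rightarrow> 'y) \<Rightarrow> 'z \<Rightarrow> ('x \<times> 'y \<times> 'z) set" where
  "KKT_solutions p q gf gg A B c =
     {(x, y, z). 0 \<in> dual_residual_set p gf A x z \<and> 0 \<in> dual_residual_set q gg B y z \<and>
                 adjoint A x + adjoint B y = c}"

definition KKT_residual ::
  "('x::euclidean_space \<Rightarrow> ereal) \<Rightarrow> ('y::euclidean_space \<Rightarrow> ereal) \<Rightarrow> ('x \<Rightarrow> 'x) \<Rightarrow> ('y \<Rightarrow> 'y) \<Rightarrow>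
   ('z::euclidean_space \<Rightarrow> 'x) \<Rightarrow> ('z \<Rightarrow> 'y) \<Rightarrow> 'z \<Rightarrow> 'x \<times> 'y \<times> 'z \<Rightarrow> ereal" where
  "KKT_residual p q gf gg A B c = (\<lambda>(x, y, z).
     (edist_to 0 (dual_residual_set p gf A x z))\<^sup>2 +
     (edist_to 0 (dual_residual_set q gg B y z))\<^sup>2 +
     ereal ((norm (adjoint A x + adjoint B y - c))\<^sup>2))"

text \<open>The operator \<open>\<Sigma> + S + \<sigma> A A\<^sup>*\<close>.\<close>

definition augmented_operator ::
  "('a::euclidean_space \<Rightarrow> 'a) \<Rightarrow> ('a \<Rightarrow> 'a) \<Rightarrow> real \<Rightarrow> ('z::euclidean_space \<Rightarrow> 'a) \<Rightarrow> 'a \<Rightarrow> 'a" where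
  "augmented_operator \<Sigma> S \<sigma> A = (\<lambda>u. \<Sigma> u + S u + \<sigma> *\<^sub>R A (adjoint A u))"

text \<open>The objective \<open>p(x) + \<langle>x, M x\<rangle> / 2 - \<langle>l, x\<rangle>\<close> of a subproblem.\<close>

definition subproblem ::
  "('a::euclidean_space \<Rightarrow> ereal) \<Rightarrow> ('a \<Rightarrow> 'a) \<Rightarrow> 'a \<Rightarrow> 'a \<Rightarrow> ereal" where
  "subproblem p M l = (\<lambda>x. p x + ereal (1/2 * (x \<bullet> M x) - l \<bullet> x))"

text \<open>In this predicate \<open>f'\<close> and \<open>g'\<close> are the gradients, \<open>\<Sigma>f\<close> and \<open>\<Sigma>g\<close> the majorization operators
  (those with a hat), and \<open>\<epsilon>\<close> the error tolerances.\<close>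

definition imsPADMM_sequence ::
  "('x::euclidean_space \<Rightarrow> ereal) \<Rightarrow> ('y::euclidean_space \<Rightarrow> ereal) \<Rightarrow> ('x \<Rightarrow> 'x) \<Rightarrow> ('y \<Rightarrow> 'y) \<Rightarrow>
   ('z::euclidean_space \<Rightarrow> 'x) \<Rightarrow> ('z \<Rightarrow> 'y) \<Rightarrow> 'z \<Rightarrow> ('x \<Rightarrow> 'x) \<Rightarrow> ('y \<Rightarrow> 'y) \<Rightarrow>
   ('x \<Rightarrow> 'x) \<Rightarrow> ('y \<Rightarrow> 'y) \<Rightarrow> real \<Rightarrow> real \<Rightarrow> (nat \<Rightarrow> real) \<Rightarrow>
   (nat \<Rightarrow> 'x) \<Rightarrow> (nat \<Rightarrow> 'y) \<Rightarrow> (nat \<Rightarrow> 'z) \<Rightarrow> bool" where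
  "imsPADMM_sequence p q f' g' A B c \<Sigma>f \<Sigma>g S T \<sigma> \<tau> \<epsilon> x y z \<longleftrightarrow>
     (let M = augmented_operator \<Sigma>f S \<sigma> A;
          N = augmented_operator \<Sigma>g T \<sigma> B;
          lx = (\<lambda>k. - (f' (x k) + A (z k) - M (x k)
                  + \<sigma> *\<^sub>R A (adjoint A (x k) + adjoint B (y k) - c)));
          ly = (\<lambda>k. - (g' (y k) + B (z k) - N (y k)
                  + \<sigma> *\<^sub>R B (adjoint A (x (Suc k)) + adjoint B (y k) - c)))
      in x 0 \<in> effective_domain p \<and> y 0 \<in> effective_domain q \<and>
         (\<forall>k.
            (\<exists>d. d \<in> subdifferential (subproblem p M (lx k)) (x (Suc k)) \<and>
                 norm (inv (psd_sqrt M) d) \<le> \<epsilon> k) \<and>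
            (\<exists>d. d \<in> subdifferential (subproblem q N (ly k)) (y (Suc k)) \<and>
                 norm (inv (psd_sqrt N) d) \<le> \<epsilon> k) \<and>
            z (Suc k) = z k + (\<tau> * \<sigma>) *\<^sub>R (adjoint A (x (Suc k)) + adjoint B (y (Suc k)) - c)))"

end

theory Submission
  imports Defs
begin

text \<open>Fix a KKT point \<open>(xs, ys, zs)\<close>. Monotonicity of the subdifferentials at the iterates and at
  the KKT point gives a one-step inequality in which only the cross term between \<open>B\<^sup>*\<close> of the
  \<open>y\<close>-step and the new constraint residual has the wrong sign. Monotonicity of \<open>\<partial>q\<close> between two
  consecutive \<open>y\<close>-iterates trades it for the cross term with the old residual, with factor
  \<open>1 - \<tau>\<close>; a weighted Young inequality absorbs this one exactly when \<open>\<tau>\<^sup>2 - \<tau> - 1 < 0\<close>.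
  The sequence converges, hence is bounded, so the inexactness contributes a summable error, and the
  squared steps and constraint residuals are summable. Positive definiteness of the two augmented
  operators turns this into summability of \<open>D(w\<^bsub>k+1\<^esub>)\<close>, which yields both rates.\<close>

subsection \<open>Square roots of positive semidefinite operators\<close>

text \<open>The subproblems linearize \<open>f\<close> and \<open>g\<close> at the old iterate, so
  monotonicity of a gradient is available only up to half the squared step in the majorization
  seminorm. The proximal term contains the same operator, and the three-point identity returns
  exactly that amount; a quarter of the squared step in the minorization seminorm survives. When
  consecutive y-iterates are compared, the linearization leaves a gradient difference of half the
  squared majorization seminorm minus \<open>g\<close>. This function is convex and again majorized
  by the same operator, so Young's inequality costs one half on each side and the step terms
  telescope without loss. That comparison needs the optimality conditions of two subproblems, and
  the initial point satisfies none; hence the descent argument starts at iterate 1. Subproblem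
  errors enter linearly, paired with distances to the KKT point, so bounded iterates and summable
  tolerances control them. Any KKT point may serve as reference, whether or not it is the limit.
  Square roots enter through the accuracy criterion and through the lower bound for positive
  definite operators.\<close>

lemma self_adjoint_eigenvector:
  fixes H :: "'a::euclidean_space \<Rightarrow> 'a"
  assumes H: "linear H" "adjoint H = H" and S: "subspace S" "H ` S \<subseteq> S" "S \<noteq> {0}"
  obtains v c where "v \<in> S" "norm v = 1" "H v = c *\<^sub>R v"
proof -
  have sa: "u \<bullet> H w = H u \<bullet> w" for u w
    using adjoint_works[OF H(1), of u w] H(2) by simp
  let ?K = "S \<inter> sphere 0 1"
  have cK: "compact ?K" using closed_Int_compact[OF closed_subspace[OF S(1)] compact_sphere] .
  obtain u where u: "u \<in> S" "u \<noteq> 0" using S(1,3) subspace_0 by blast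
  have "(1 / norm u) *\<^sub>R u \<in> ?K" using u S(1) by (simp add: subspace_scale)
  then have neK: "?K \<noteq> {}" by blast
  have "continuous_on ?K (\<lambda>v. v \<bullet> H v)"
    by (intro continuous_intros linear_continuous_on) (use H(1) linear_conv_bounded_linear in blast)
  then obtain v where v: "v \<in> ?K" and vmax: "\<And>u. u \<in> ?K \<Longrightarrow> u \<bullet> H u \<le> v \<bullet> H v"
    using continuous_attains_sup[OF cK neK] by blast
  define c where "c = v \<bullet> H v"
  have vv: "v \<bullet> v = 1" using v by (simp add: dot_square_norm)
  have G: "u \<bullet> H u \<le> c * (u \<bullet> u)" if "u \<in> S" for u
  proof (cases "u = 0")
    case True then show ?thesis using linear_0[OF H(1)] by simp
  next
    case False
    have "(1 / norm u) *\<^sub>R u \<in> ?K" using that False S(1) by (simp add: subspace_scale)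
    from vmax[OF this] have "(u \<bullet> H u) / (norm u)^2 \<le> c"
      by (simp add: linear_scale[OF H(1)] c_def power2_eq_square)
    then show ?thesis using False by (simp add: field_simps dot_square_norm)
  qed
  \<comment> \<open>The vector \<open>v\<close> maximizes the Rayleigh quotient on the unit sphere
    of \<open>S\<close>, and \<open>w\<close> is its defect as an eigenvector. Perturbing
    \<open>v\<close> in the direction \<open>w\<close> changes the quotient to first order by the
    squared norm of \<open>w\<close>, so maximality forces \<open>w = 0\<close>.\<close>
  define w where "w = H v - c *\<^sub>R v"
  have wS: "w \<in> S" unfolding w_def
    using v S by (auto intro!: subspace_diff subspace_scale)
  define g where "g = c * (w \<bullet> w) - w \<bullet> H w"
  have wv: "w \<bullet> (c *\<^sub>R v) - w \<bullet> H v = - (w \<bullet> w)" by (simp add: w_def inner_diff_right inner_diff_left)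
  have ineq: "0 \<le> t^2 * g - 2 * t * (w \<bullet> w)" for t
  proof -
    have "v + t *\<^sub>R w \<in> S" using v wS S(1) by (auto intro!: subspace_add subspace_scale)
    from G[OF this] have "0 \<le> c * ((v + t *\<^sub>R w) \<bullet> (v + t *\<^sub>R w)) - (v + t *\<^sub>R w) \<bullet> H (v + t *\<^sub>R w)"
      by simp
    also have "\<dots> = t^2 * g + 2 * t * (w \<bullet> (c *\<^sub>R v) - w \<bullet> H v)"
      using sa[of v w]
      by (simp add: linear_add[OF H(1)] linear_scale[OF H(1)] inner_add_left inner_add_right vv
          c_def g_def inner_commute algebra_simps power2_eq_square)
    finally show ?thesis unfolding wv by simp
  qed
  have "w = 0"
  proof (rule ccontr)
    assume "w \<noteq> 0"
    then have N: "w \<bullet> w > 0" by simp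
    have g0: "g \<ge> 0" using G[OF wS] by (simp add: g_def)
    \<comment> \<open>A step so short that the quadratic term \<open>t * g\<close> is at most
      \<open>w \<bullet> w\<close> and cannot offset the linear term.\<close>
    define t where "t = (w \<bullet> w) / (g + 1)"
    have tp: "t > 0" using N g0 by (simp add: t_def)
    have "t * (t * g - 2 * (w \<bullet> w)) \<ge> 0" using ineq[of t] by (simp add: algebra_simps power2_eq_square)
    then have "t * g \<ge> 2 * (w \<bullet> w)" using tp by (simp add: zero_le_mult_iff)
    moreover have "t * g \<le> w \<bullet> w" using N g0 by (simp add: t_def field_simps)
    ultimately show False using N by simp
  qed
  then have "H v = c *\<^sub>R v" by (simp add: w_def)
  then show thesis using v that by auto
qed

text \<open>Self-adjointness makes the orthogonal complement of an eigenvector inside an invariant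
  subspace invariant again; stating the result for invariant subspaces lets the induction on the
  dimension run.\<close>

theorem self_adjoint_eigenbasis:
  fixes H :: "'a::euclidean_space \<Rightarrow> 'a"
  assumes H: "linear H" "adjoint H = H" and S: "subspace S" "H ` S \<subseteq> S"
  shows "\<exists>E. finite E \<and> pairwise orthogonal E \<and> span E = S \<and>
    (\<forall>b\<in>E. norm b = 1 \<and> (\<exists>c. H b = c *\<^sub>R b))"
  using S
proof (induction "dim S" arbitrary: S rule: less_induct)
  case less
  have sa: "u \<bullet> H w = H u \<bullet> w" for u w
    using adjoint_works[OF H(1), of u w] H(2) by simp
  show ?case
  proof (cases "S = {0}")
    case True
    then show ?thesis by (intro exI[of _ "{}"]) simp
  next
    case False
    obtain v c where v: "v \<in> S" "norm v = 1" "H v = c *\<^sub>R v"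
      using self_adjoint_eigenvector[OF H less.prems False] .
    have vv: "v \<bullet> v = 1" using v by (simp add: dot_square_norm)
    define S' where "S' = {u \<in> S. u \<bullet> v = 0}"
    have subS: "subspace S'" using less.prems(1)
      by (auto simp: S'_def subspace_def inner_add_left)
    have inv: "H ` S' \<subseteq> S'" using less.prems(2) by (auto simp: S'_def sa[symmetric] v(3))
    have "v \<notin> S'" by (simp add: S'_def vv)
    moreover have "S' \<subseteq> S" by (auto simp: S'_def)
    ultimately have "S' \<subset> S" using v(1) by blast
    then have "dim S' < dim S" by (intro dim_psubset) (simp add: subS less.prems(1) span_eq_iff[THEN iffD2])
    then obtain E where E: "finite E" "pairwise orthogonal E" "span E = S'"
      "\<forall>b\<in>E. norm b = 1 \<and> (\<exists>c. H b = c *\<^sub>R b)"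
      using less.hyps[OF _ subS inv] by blast
    have ES: "E \<subseteq> S'" using E(3) span_superset by blast
    have "span (insert v E) = S"
    proof
      show "span (insert v E) \<subseteq> S"
        by (rule span_minimal) (use v ES less.prems in \<open>auto simp: S'_def\<close>)
      show "S \<subseteq> span (insert v E)"
      proof
        fix u assume u: "u \<in> S"
        have "u - (u \<bullet> v) *\<^sub>R v \<in> S'"
          using u v less.prems(1) vv by (auto simp: S'_def inner_diff_left intro!: subspace_diff subspace_scale)
        then have "u - (u \<bullet> v) *\<^sub>R v \<in> span E" using E(3) by simp
        then show "u \<in> span (insert v E)" by (auto simp: span_insert)
      qed
    qed
    moreover have "pairwise orthogonal (insert v E)"
      using E(2) ES by (auto simp: pairwise_insert S'_def orthogonal_def inner_commute)
    ultimately show ?thesis using E v by (intro exI[of _ "insert v E"]) auto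
  qed
qed

lemma psd_operator_symmetric:
  assumes "psd_operator H" shows "H u \<bullet> w = u \<bullet> H w"
  using adjoint_works[of H u w] assms by (simp add: psd_operator_def)

lemma pd_operator_imp_psd: "pd_operator H \<Longrightarrow> psd_operator H"
  unfolding pd_operator_def psd_operator_def by (metis inner_zero_left less_imp_le order_refl)

lemma psd_square_root_exists:
  fixes H :: "'a::euclidean_space \<Rightarrow> 'a"
  assumes "psd_operator H"
  obtains R where "psd_operator R" "R \<circ> R = H"
proof -
  have H: "linear H" "adjoint H = H" "\<And>u. 0 \<le> u \<bullet> H u" using assms by (auto simp: psd_operator_def)
  obtain E where E: "finite E" "pairwise orthogonal E" "span E = UNIV"
      "\<forall>b\<in>E. norm b = 1 \<and> (\<exists>c. H b = c *\<^sub>R b)"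
    using self_adjoint_eigenbasis[OF H(1,2), of UNIV] by auto
  then obtain l where l: "\<And>b. b \<in> E \<Longrightarrow> H b = l b *\<^sub>R b" by metis
  have bb: "b \<bullet> b = 1" if "b \<in> E" for b using that E(4) by (simp add: dot_square_norm)
  have l0: "l b \<ge> 0" if "b \<in> E" for b using H(3)[of b] that by (simp add: l bb)
  define R where "R = (\<lambda>u. \<Sum>b\<in>E. (sqrt (l b) * (u \<bullet> b)) *\<^sub>R b)"
  have linR: "linear R"
    by (rule linearI) (simp_all add: R_def inner_add_left scaleR_add_left distrib_left sum.distrib
        scaleR_right.sum mult.left_commute)
  have sym: "u \<bullet> R w = R u \<bullet> w" for u w
    by (simp add: R_def inner_sum_left inner_sum_right inner_commute mult_ac)
  have adjR: "adjoint R = R" by (rule adjoint_unique) (simp add: sym)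
  have psd: "u \<bullet> R u \<ge> 0" for u
    by (auto simp: R_def inner_sum_right l0 mult.assoc intro!: sum_nonneg)
  have Rb: "R b = sqrt (l b) *\<^sub>R b" if b: "b \<in> E" for b
  proof -
    have "R b = (\<Sum>b'\<in>E. if b' = b then sqrt (l b) *\<^sub>R b else 0)"
      unfolding R_def using E(2) b
      by (intro sum.cong) (auto simp: bb pairwise_def orthogonal_def)
    then show ?thesis using E(1) b by simp
  qed
  have "(R \<circ> R) u = H u" for u
  proof (rule linear_eq_on_span[of "R \<circ> R" H E])
    show "linear (R \<circ> R)" using linR by (simp add: linear_compose)
    show "(R \<circ> R) b = H b" if "b \<in> E" for b
      using that l0 by (simp add: Rb l linear_scale[OF linR] )
  qed (use E H in auto)
  then have "R \<circ> R = H" by (rule ext)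
  moreover have "psd_operator R" using linR adjR psd by (simp add: psd_operator_def)
  ultimately show thesis using that by blast
qed

text \<open>Factor \<open>R\<^sup>2 - c\<close> as \<open>(R + sqrt c) (R - sqrt c)\<close>: a
  nonzero \<open>(R - sqrt c) b\<close> would be an eigenvector of \<open>R\<close> for the negative
  value \<open>- sqrt c\<close>. Two roots of the same operator therefore agree on its eigenbasis,
  which is the uniqueness that \<open>psd_sqrt\<close> needs.\<close>

lemma psd_square_root_eigenvector:
  fixes R :: "'a::euclidean_space \<Rightarrow> 'a"
  assumes R: "psd_operator R" and b: "R (R b) = c *\<^sub>R b" and c: "c \<ge> 0"
  shows "R b = sqrt c *\<^sub>R b"
proof (cases "c = 0")
  case True
  have "R b \<bullet> R b = b \<bullet> R (R b)" using psd_operator_symmetric[OF R] by simp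
  then show ?thesis using True b by simp
next
  case False
  have lin: "linear R" using R by (simp add: psd_operator_def)
  define w where "w = R b - sqrt c *\<^sub>R b"
  have "R w = - (sqrt c *\<^sub>R w)"
    using c by (simp add: w_def linear_diff[OF lin] linear_scale[OF lin] b algebra_simps)
  then have "w \<bullet> R w = - (sqrt c * (w \<bullet> w))" by simp
  moreover have "w \<bullet> R w \<ge> 0" using R by (simp add: psd_operator_def)
  ultimately have "sqrt c * (w \<bullet> w) \<le> 0" by simp
  then have "w \<bullet> w \<le> 0" using False c by (simp add: mult_le_0_iff)
  then have "w = 0" by (metis inner_gt_zero_iff not_less)
  then show ?thesis by (simp add: w_def)
qed

lemma psd_square_root_unique:
  fixes R R' :: "'a::euclidean_space \<Rightarrow> 'a"
  assumes H: "psd_operator H" and R: "psd_operator R" "R \<circ> R = H" and R': "psd_operator R'" "R' \<circ> R' = H"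
  shows "R = R'"
proof
  fix u
  obtain E where E: "span E = UNIV" "\<forall>b\<in>E. norm b = 1 \<and> (\<exists>c. H b = c *\<^sub>R b)"
    using self_adjoint_eigenbasis[of H UNIV] H by (auto simp: psd_operator_def)
  show "R u = R' u"
  proof (rule linear_eq_on_span[of R R' E])
    fix b assume "b \<in> E"
    then obtain c where c: "H b = c *\<^sub>R b" and n: "norm b = 1" using E by blast
    have "0 \<le> b \<bullet> H b" using H by (simp add: psd_operator_def)
    then have "c \<ge> 0" using n by (simp add: c dot_square_norm)
    moreover have "R (R b) = c *\<^sub>R b" "R' (R' b) = c *\<^sub>R b"
      using R(2) R'(2) c by (metis comp_apply)+
    ultimately show "R b = R' b" using psd_square_root_eigenvector R(1) R'(1) by metis
  qed (use R R' E in \<open>auto simp: psd_operator_def\<close>)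
qed

lemma psd_sqrt:
  fixes H :: "'a::euclidean_space \<Rightarrow> 'a"
  assumes "psd_operator H"
  shows "psd_operator (psd_sqrt H)" "psd_sqrt H \<circ> psd_sqrt H = H"
proof -
  obtain R where R: "psd_operator R" "R \<circ> R = H" using psd_square_root_exists[OF assms] .
  have "psd_operator (psd_sqrt H) \<and> psd_sqrt H \<circ> psd_sqrt H = H"
    unfolding psd_sqrt_def
  proof (rule theI[where P = "\<lambda>R. psd_operator R \<and> R \<circ> R = H"])
    show "psd_operator R \<and> R \<circ> R = H" using R by simp
    show "R' = R" if "psd_operator R' \<and> R' \<circ> R' = H" for R'
      using psd_square_root_unique[OF assms] that R by blast
  qed
  then show "psd_operator (psd_sqrt H)" "psd_sqrt H \<circ> psd_sqrt H = H" by auto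
qed

lemma psd_sqrt_pd_inj:
  fixes M :: "'a::euclidean_space \<Rightarrow> 'a"
  assumes M: "pd_operator M"
  shows "linear (psd_sqrt M)" "inj (psd_sqrt M)"
proof -
  note sq = psd_sqrt[OF pd_operator_imp_psd[OF M]]
  show "linear (psd_sqrt M)" using sq(1) by (simp add: psd_operator_def)
  have linM: "linear M" using M by (simp add: pd_operator_def)
  have "inj M"
    unfolding linear_injective_0[OF linM] using M by (force simp: pd_operator_def)
  then show "inj (psd_sqrt M)" using sq(2) by (metis inj_on_imageI2)
qed

text \<open>Converts the accuracy criterion of the algorithm into a bound in the plain norm. The
  root of a positive definite operator is bijective, so \<open>inv\<close> is its true
  inverse.\<close>

lemma norm_le_inv_psd_sqrt:
  fixes M :: "'a::euclidean_space \<Rightarrow> 'a"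
  assumes M: "pd_operator M"
  obtains C where "C > 0" "\<And>d. norm d \<le> C * norm (inv (psd_sqrt M) d)"
proof -
  let ?R = "psd_sqrt M"
  have "surj ?R" using psd_sqrt_pd_inj[OF M] linear_injective_imp_surjective by blast
  then have Rinv: "?R (inv ?R d) = d" for d by (simp add: surj_f_inv_f)
  obtain C where "C > 0" "\<And>u. norm (?R u) \<le> C * norm u"
    using linear_bounded_pos[OF psd_sqrt_pd_inj(1)[OF M]] by blast
  then show thesis using that Rinv by metis
qed

lemma pd_operator_bounded_below:
  fixes M :: "'a::euclidean_space \<Rightarrow> 'a"
  assumes M: "pd_operator M"
  obtains C where "C > 0" "\<And>u. (norm u)\<^sup>2 \<le> C * sqnorm_wrt M u"
proof -
  note sq = psd_sqrt[OF pd_operator_imp_psd[OF M]]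
  obtain b where b: "b > 0" "\<And>u. b * norm u \<le> norm (psd_sqrt M u)"
    using linear_inj_bounded_below_pos[OF psd_sqrt_pd_inj[OF M]] by (metis mult.commute)
  have "(norm u)\<^sup>2 \<le> 1 / b\<^sup>2 * sqnorm_wrt M u" for u
  proof -
    have "M u = psd_sqrt M (psd_sqrt M u)" using sq(2) by (metis comp_apply)
    then have "sqnorm_wrt M u = (norm (psd_sqrt M u))\<^sup>2"
      by (simp add: sqnorm_wrt_def dot_square_norm flip: psd_operator_symmetric[OF sq(1)])
    moreover have "(b * norm u)\<^sup>2 \<le> (norm (psd_sqrt M u))\<^sup>2" using b by (intro power_mono) auto
    ultimately show ?thesis using b(1) by (simp add: field_simps power_mult_distrib)
  qed
  then show thesis using that[of "1 / b\<^sup>2"] b(1) by auto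
qed

subsection \<open>Convex functions of one block and their subdifferentials\<close>

lemma block_decomposition_exists:
  assumes V: "\<And>i. i \<in> I \<Longrightarrow> subspace (V i)" and I: "finite I" and sp: "span (\<Union>i\<in>I. V i) = UNIV"
  shows "\<exists>u. (\<forall>i\<in>I. u i \<in> V i) \<and> x = (\<Sum>i\<in>I. u i)"
proof -
  let ?W = "{x. \<exists>u. (\<forall>i\<in>I. u i \<in> V i) \<and> x = (\<Sum>i\<in>I. u i)}"
  have "subspace ?W"
    unfolding subspace_def
  proof (safe)
    show "\<exists>u. (\<forall>i\<in>I. u i \<in> V i) \<and> 0 = (\<Sum>i\<in>I. u i)"
      by (rule exI[of _ "\<lambda>_. 0"]) (simp add: V subspace_0)
  next
    fix u w assume "\<forall>i\<in>I. u i \<in> V i" "\<forall>i\<in>I. w i \<in> V i"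
    then show "\<exists>v. (\<forall>i\<in>I. v i \<in> V i) \<and> sum u I + sum w I = sum v I"
      by (intro exI[of _ "\<lambda>i. u i + w i"]) (simp add: V subspace_add sum.distrib)
  next
    fix r :: real and u assume "\<forall>i\<in>I. u i \<in> V i"
    then show "\<exists>v. (\<forall>i\<in>I. v i \<in> V i) \<and> r *\<^sub>R sum u I = sum v I"
      by (intro exI[of _ "\<lambda>i. r *\<^sub>R u i"]) (simp add: V subspace_scale scaleR_sum_right)
  qed
  moreover have "(\<Union>i\<in>I. V i) \<subseteq> ?W"
  proof
    fix v assume "v \<in> (\<Union>i\<in>I. V i)"
    then obtain j where j: "j \<in> I" "v \<in> V j" by blast
    then show "v \<in> ?W"
      using I V by (intro CollectI exI[of _ "\<lambda>i. if i = j then v else 0"]) (simp add: subspace_0)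
  qed
  ultimately have "span (\<Union>i\<in>I. V i) \<subseteq> ?W" by (intro span_minimal)
  then show ?thesis using sp by blast
qed

lemma block_decomposition_unique:
  fixes u w :: "'i \<Rightarrow> 'a::real_inner"
  assumes V: "\<And>i. i \<in> I \<Longrightarrow> subspace (V i)" and I: "finite I"
    and orth: "\<And>i j a b. i \<in> I \<Longrightarrow> j \<in> I \<Longrightarrow> i \<noteq> j \<Longrightarrow> a \<in> V i \<Longrightarrow> b \<in> V j \<Longrightarrow> orthogonal a b"
    and u: "\<And>i. i \<in> I \<Longrightarrow> u i \<in> V i" and w: "\<And>i. i \<in> I \<Longrightarrow> w i \<in> V i"
    and eq: "(\<Sum>i\<in>I. u i) = (\<Sum>i\<in>I. w i)" and j: "j \<in> I"
  shows "u j = w j"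
proof -
  have d: "u i - w i \<in> V i" if "i \<in> I" for i using that by (simp add: V u w subspace_diff)
  have "0 = (u j - w j) \<bullet> (\<Sum>i\<in>I. u i - w i)" by (simp add: sum_subtractf eq)
  also have "\<dots> = (\<Sum>i\<in>I. if i = j then (u j - w j) \<bullet> (u j - w j) else 0)"
    unfolding inner_sum_right
  proof (rule sum.cong)
    fix i assume i: "i \<in> I"
    show "(u j - w j) \<bullet> (u i - w i) = (if i = j then (u j - w j) \<bullet> (u j - w j) else 0)"
      using orth[OF j i _ d[OF j] d[OF i]] by (auto simp: orthogonal_def)
  qed simp
  also have "\<dots> = (u j - w j) \<bullet> (u j - w j)" using I j by simp
  finally show ?thesis by simp
qed

lemma block_components_eqI:
  assumes ob: "orthogonal_blocks m V" and u: "\<And>i. i \<in> {1..m} \<Longrightarrow> u i \<in> V i"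
    and x: "x = (\<Sum>i=1..m. u i)" and j: "j \<in> {1..m}"
  shows "block_components m V x j = u j"
proof -
  have V: "\<And>i. i \<in> {1..m} \<Longrightarrow> subspace (V i)"
    and orth: "\<And>i j a b. i \<in> {1..m} \<Longrightarrow> j \<in> {1..m} \<Longrightarrow> i \<noteq> j \<Longrightarrow> a \<in> V i \<Longrightarrow> b \<in> V j \<Longrightarrow> orthogonal a b"
    using ob unfolding orthogonal_blocks_def by blast+
  \<comment> \<open>Restriction fixes the values outside \<open>{1..m}\<close>; without it the tuple
    would not be the unique one that \<open>THE\<close> asks for.\<close>
  have "block_components m V x = restrict u {1..m}"
    unfolding block_components_def
  proof (rule the_equality)
    show "restrict u {1..m} \<in> (\<Pi>\<^sub>E i\<in>{1..m}. V i) \<and> x = (\<Sum>i=1..m. restrict u {1..m} i)"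
      using u x by auto
  next
    fix w assume w: "w \<in> (\<Pi>\<^sub>E i\<in>{1..m}. V i) \<and> x = (\<Sum>i=1..m. w i)"
    show "w = restrict u {1..m}"
    proof
      fix i
      show "w i = restrict u {1..m} i"
      proof (cases "i \<in> {1..m}")
        case True
        have "w i = u i"
          by (rule block_decomposition_unique[where I = "{1..m}" and V = V and u = w and w = u])
            (use V orth w u x True in auto)
        then show ?thesis using True by simp
      qed (use w in \<open>auto simp: PiE_def extensional_def\<close>)
    qed
  qed
  then show ?thesis using j by simp
qed

lemma block_components_decomposition:
  assumes ob: "orthogonal_blocks m V"
  shows "\<And>i. i \<in> {1..m} \<Longrightarrow> block_components m V x i \<in> V i"
    and "x = (\<Sum>i=1..m. block_components m V x i)"
proof -
  obtain u where u: "\<forall>i\<in>{1..m}. u i \<in> V i" "x = (\<Sum>i=1..m. u i)"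
    using block_decomposition_exists[of "{1..m}" V x] ob unfolding orthogonal_blocks_def by blast
  have eq: "block_components m V x i = u i" if "i \<in> {1..m}" for i
    using block_components_eqI[OF ob _ u(2) that] u(1) by blast
  then show "\<And>i. i \<in> {1..m} \<Longrightarrow> block_components m V x i \<in> V i" using u(1) by auto
  show "x = (\<Sum>i=1..m. block_components m V x i)" using u(2) eq by simp
qed

lemma block_components_affine:
  assumes ob: "orthogonal_blocks m V" and j: "j \<in> {1..m}"
  shows "block_components m V (a *\<^sub>R x + b *\<^sub>R y) j =
    a *\<^sub>R block_components m V x j + b *\<^sub>R block_components m V y j"
proof (rule block_components_eqI[OF ob _ _ j])
  note dec = block_components_decomposition[OF ob]
  show "a *\<^sub>R block_components m V x i + b *\<^sub>R block_components m V y i \<in> V i" if "i \<in> {1..m}" for i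
    using that ob dec(1) by (auto simp: orthogonal_blocks_def intro!: subspace_add subspace_scale)
  show "a *\<^sub>R x + b *\<^sub>R y = (\<Sum>i=1..m. a *\<^sub>R block_components m V x i + b *\<^sub>R block_components m V y i)"
    unfolding sum.distrib scaleR_sum_right[symmetric] dec(2)[symmetric] ..
qed

lemma block_components_single:
  assumes ob: "orthogonal_blocks m V" and j: "j \<in> {1..m}" and x: "x \<in> V j"
  shows "block_components m V x j = x"
proof -
  have "block_components m V x j = (if j = j then x else 0)"
    by (rule block_components_eqI[where u = "\<lambda>i. if i = j then x else 0", OF ob])
      (use ob j x in \<open>auto simp: orthogonal_blocks_def subspace_0\<close>)
  then show ?thesis by simp
qed

definition proper_convex :: "('a::euclidean_space \<Rightarrow> ereal) \<Rightarrow> bool" where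
  "proper_convex p \<longleftrightarrow>
     (\<forall>x. p x \<noteq> -\<infinity>) \<and> (\<exists>x. p x \<noteq> \<infinity>) \<and> convex (epigraph_on UNIV p)"

text \<open>Taking the block component is a linear map onto \<open>V j\<close>: linearity carries
  convexity of the epigraph over, surjectivity carries over a point of finite value.\<close>

lemma proper_convex_block:
  assumes ob: "orthogonal_blocks m V" and j: "j \<in> {1..m}" and p: "closed_proper_convex_on (V j) p"
  shows "proper_convex (\<lambda>u. p (block_components m V u j))"
  unfolding proper_convex_def
proof (intro conjI)
  note dec = block_components_decomposition[OF ob]
  show "\<forall>x. p (block_components m V x j) \<noteq> -\<infinity>"
    using p dec(1)[OF j] by (auto simp: closed_proper_convex_on_def)
  show "\<exists>x. p (block_components m V x j) \<noteq> \<infinity>"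
    using p block_components_single[OF ob j] by (metis closed_proper_convex_on_def)
  have "convex (epigraph_on (V j) p)" using p by (simp add: closed_proper_convex_on_def)
  note cv = convexD[OF this]
  show "convex (epigraph_on UNIV (\<lambda>u. p (block_components m V u j)))"
  proof (rule convexI)
    fix P Q :: "'a \<times> real" and a b :: real
    assume P: "P \<in> epigraph_on UNIV (\<lambda>u. p (block_components m V u j))"
      and Q: "Q \<in> epigraph_on UNIV (\<lambda>u. p (block_components m V u j))"
      and ab: "0 \<le> a" "0 \<le> b" "a + b = 1"
    have "a *\<^sub>R (block_components m V (fst P) j, snd P) + b *\<^sub>R (block_components m V (fst Q) j, snd Q)
        \<in> epigraph_on (V j) p"
      by (rule cv) (use P Q ab dec(1)[OF j] in \<open>auto simp: epigraph_on_def\<close>)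
    then show "a *\<^sub>R P + b *\<^sub>R Q \<in> epigraph_on UNIV (\<lambda>u. p (block_components m V u j))"
      by (cases P; cases Q) (simp add: epigraph_on_def block_components_affine[OF ob j])
  qed
qed

lemma proper_subdifferential_finite:
  assumes p: "proper_convex p" and v: "v \<in> subdifferential p x"
  obtains r where "p x = ereal r"
proof (cases "p x")
  case PInf
  obtain u where "p u \<noteq> \<infinity>" using p by (auto simp: proper_convex_def)
  moreover have "p x + ereal (v \<bullet> (u - x)) \<le> p u" using v by (auto simp: subdifferential_def)
  ultimately have False using PInf by simp
  then show thesis ..
next
  case MInf
  then have False using p by (simp add: proper_convex_def)
  then show thesis ..
qed (use that in blast)

lemma subdifferential_monotone:
  assumes p: "proper_convex p" and v: "v \<in> subdifferential p x" and w: "w \<in> subdifferential p y"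
  shows "0 \<le> (v - w) \<bullet> (x - y)"
proof -
  obtain r where r: "p x = ereal r" using proper_subdifferential_finite[OF p v] .
  obtain s where s: "p y = ereal s" using proper_subdifferential_finite[OF p w] .
  have "p x + ereal (v \<bullet> (y - x)) \<le> p y" "p y + ereal (w \<bullet> (x - y)) \<le> p x"
    using v w by (auto simp: subdifferential_def)
  then have "r + v \<bullet> (y - x) \<le> s" "s + w \<bullet> (x - y) \<le> r" by (auto simp: r s)
  then show ?thesis by (simp add: inner_diff_left inner_diff_right)
qed

text \<open>The sum rule for a convex function plus a smooth quadratic: test the subgradient
  inequality at \<open>x + t *\<^sub>R (u - x)\<close>, use convexity of \<open>p\<close> on the
  segment, divide by \<open>t\<close> and let \<open>t\<close> become small.\<close>

lemma subdifferential_subproblem: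
  fixes M :: "'a::euclidean_space \<Rightarrow> 'a"
  assumes p: "proper_convex p" and M: "linear M" "\<And>u w. M u \<bullet> w = u \<bullet> M w"
    and d: "d \<in> subdifferential (subproblem p M l) x"
  shows "d - M x + l \<in> subdifferential p x"
proof -
  have d': "p x + ereal (1/2 * (x \<bullet> M x) - l \<bullet> x) + ereal (d \<bullet> (u - x))
      \<le> p u + ereal (1/2 * (u \<bullet> M u) - l \<bullet> u)" for u
    using d by (simp add: subdifferential_def subproblem_def)
  have "p x \<noteq> \<infinity>"
  proof
    assume inf: "p x = \<infinity>"
    obtain u where "p u \<noteq> \<infinity>" using p by (auto simp: proper_convex_def)
    then show False using d'[of u] inf by (cases "p u") auto
  qed
  then obtain r where r: "p x = ereal r" using p by (cases "p x") (auto simp: proper_convex_def)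
  have "p x + ereal ((d - M x + l) \<bullet> (u - x)) \<le> p u" for u
  proof (cases "p u")
    case (real s)
    define h where "h = u - x"
    \<comment> \<open>\<open>a\<close> is the amount by which the claimed inequality fails at
      \<open>u\<close>, and \<open>t * G\<close> is the quadratic remainder after division by
      \<open>t\<close>.\<close>
    define a where "a = r + (d - M x + l) \<bullet> h - s"
    define G where "G = 1/2 * (h \<bullet> M h)"
    have step: "a \<le> t * G" if t: "0 < t" "t \<le> 1" for t
    proof -
      have "convex (epigraph_on UNIV p)" using p by (simp add: proper_convex_def)
      then have "(1 - t) *\<^sub>R (x, r) + t *\<^sub>R (u, s) \<in> epigraph_on UNIV p"
        by (rule convexD) (use t r real in \<open>auto simp: epigraph_on_def\<close>)
      then have c: "p (x + t *\<^sub>R h) \<le> ereal ((1 - t) * r + t * s)"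
        by (simp add: epigraph_on_def h_def algebra_simps)
      have "ereal (r + (1/2 * (x \<bullet> M x) - l \<bullet> x) + d \<bullet> (t *\<^sub>R h))
          \<le> p (x + t *\<^sub>R h) + ereal (1/2 * ((x + t *\<^sub>R h) \<bullet> M (x + t *\<^sub>R h)) - l \<bullet> (x + t *\<^sub>R h))"
        using d'[of "x + t *\<^sub>R h"] by (simp add: r)
      also have "\<dots> \<le> ereal ((1 - t) * r + t * s) +
          ereal (1/2 * ((x + t *\<^sub>R h) \<bullet> M (x + t *\<^sub>R h)) - l \<bullet> (x + t *\<^sub>R h))"
        using c by (rule add_right_mono)
      finally have "r + (1/2 * (x \<bullet> M x) - l \<bullet> x) + d \<bullet> (t *\<^sub>R h)
          \<le> (1 - t) * r + t * s + (1/2 * ((x + t *\<^sub>R h) \<bullet> M (x + t *\<^sub>R h)) - l \<bullet> (x + t *\<^sub>R h))"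
        by simp
      then have "t * a \<le> t * (t * G)"
        using M(2)[of x h]
        by (simp add: linear_add[OF M(1)] linear_scale[OF M(1)] inner_add_left inner_add_right
            inner_diff_left a_def G_def algebra_simps inner_commute)
      then show ?thesis using t by simp
    qed
    have "a \<le> 0"
    proof (rule ccontr)
      assume a: "\<not> a \<le> 0"
      have G: "a \<le> G" using step[of 1] by simp
      \<comment> \<open>The choice \<open>t = a / (2 * G)\<close> yields
        \<open>a \<le> a / 2\<close>; it is admissible because \<open>t = 1\<close> already gave
        \<open>a \<le> G\<close>.\<close>
      have "a \<le> a / (2 * G) * G" by (rule step) (use a G in \<open>auto simp: field_simps\<close>)
      then show False using a G by (simp add: field_simps)
    qed
    then show ?thesis by (simp add: r real a_def h_def)
  next
    case MInf then show ?thesis using p by (simp add: proper_convex_def)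
  qed simp
  then show ?thesis by (simp add: subdifferential_def)
qed

subsection \<open>Majorized proximal steps\<close>

lemma sqnorm_wrt_nonneg: "psd_operator H \<Longrightarrow> 0 \<le> sqnorm_wrt H u"
  by (simp add: psd_operator_def sqnorm_wrt_def)

lemma psd_operator_add:
  assumes "psd_operator G" "psd_operator H"
  shows "psd_operator (\<lambda>u. G u + H u)"
  unfolding psd_operator_def
proof (intro conjI allI)
  show "linear (\<lambda>u. G u + H u)" using assms by (simp add: psd_operator_def linear_compose_add)
  show "adjoint (\<lambda>u. G u + H u) = (\<lambda>u. G u + H u)"
    by (rule adjoint_unique) (simp add: inner_add_left inner_add_right assms psd_operator_symmetric)
  show "0 \<le> u \<bullet> (G u + H u)" for u using assms by (simp add: psd_operator_def inner_add_right)
qed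

lemma sqnorm_wrt_commute: "linear H \<Longrightarrow> sqnorm_wrt H (u - v) = sqnorm_wrt H (v - u)"
  using linear_neg[of H "v - u"] by (simp add: sqnorm_wrt_def inner_diff_left)

lemma sqnorm_wrt_add: "sqnorm_wrt (\<lambda>u. G u + H u) u = sqnorm_wrt G u + sqnorm_wrt H u"
  by (simp add: sqnorm_wrt_def inner_add_right)

lemma psd_three_point:
  assumes H: "psd_operator H"
  shows "H (b - a) \<bullet> b = 1/2 * (sqnorm_wrt H b - sqnorm_wrt H a + sqnorm_wrt H (b - a))"
  using H psd_operator_symmetric[OF H, of a b]
  by (simp add: psd_operator_def linear_diff sqnorm_wrt_def inner_diff_left inner_diff_right inner_commute)

lemma psd_young:
  assumes H: "psd_operator H"
  shows "H a \<bullet> b \<le> 1/2 * sqnorm_wrt H a + 1/2 * sqnorm_wrt H b"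
  using H psd_operator_symmetric[OF H, of a b] sqnorm_wrt_nonneg[OF H, of "a - b"]
  by (simp add: psd_operator_def linear_diff sqnorm_wrt_def inner_diff_left inner_diff_right inner_commute)

lemma psd_half_diff:
  assumes H: "psd_operator H"
  shows "1/2 * sqnorm_wrt H (a - b) \<le> sqnorm_wrt H a + sqnorm_wrt H b"
  using H psd_operator_symmetric[OF H, of a b] sqnorm_wrt_nonneg[OF H, of "a + b"]
  by (simp add: psd_operator_def linear_diff linear_add sqnorm_wrt_def inner_diff_left inner_diff_right
      inner_add_left inner_add_right inner_commute)

text \<open>Add the lower bounds from \<open>x\<close> to \<open>s\<close> and from \<open>s\<close>
  to \<open>x'\<close> to the upper bound from \<open>x\<close> to \<open>x'\<close>; all function
  values cancel. The two squares in \<open>L\<close> thus obtained are merged by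
  \<open>psd_half_diff\<close>, whence the factor 1/4.\<close>

lemma majorized_gradient_lower:
  fixes f :: "'a::euclidean_space \<Rightarrow> real"
  assumes L: "psd_operator L"
    and lower: "\<And>u v. 1/2 * sqnorm_wrt L (u - v) \<le> f u - f v - f' v \<bullet> (u - v)"
    and upper: "\<And>u v. f u - f v - f' v \<bullet> (u - v) \<le> 1/2 * sqnorm_wrt H (u - v)"
  shows "1/4 * sqnorm_wrt L (x' - x) - 1/2 * sqnorm_wrt H (x' - x) \<le> (f' x - f' s) \<bullet> (x' - s)"
  using psd_half_diff[OF L, of "x' - s" "x - s"] upper[of x' x] lower[of s x] lower[of x' s]
    sqnorm_wrt_commute[of L s x] L
  by (simp add: inner_diff_right inner_diff_left psd_operator_def)

text \<open>Cocoercivity in a form that does not need \<open>H\<close> to be invertible: compare the upper bound at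
  \<open>v + w\<close> based at \<open>v\<close> with the lower bound based at \<open>u\<close>.\<close>

lemma gradient_difference_young:
  assumes lower: "\<And>u v. 0 \<le> \<phi> u - \<phi> v - \<phi>' v \<bullet> (u - v)"
    and upper: "\<And>u v. \<phi> u - \<phi> v - \<phi>' v \<bullet> (u - v) \<le> 1/2 * sqnorm_wrt H (u - v)"
    and H: "linear H"
  shows "(\<phi>' u - \<phi>' v) \<bullet> w \<le> 1/2 * sqnorm_wrt H (u - v) + 1/2 * sqnorm_wrt H w"
  using upper[of "v + w" v] lower[of "v + w" u] upper[of v u] sqnorm_wrt_commute[OF H, of v u]
  by (simp add: inner_diff_left inner_diff_right inner_add_right)

text \<open>Half the squared seminorm of \<open>H\<close> minus \<open>g\<close> is convex because
  \<open>H\<close> majorizes \<open>g\<close>, and it is itself majorized by \<open>H\<close>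
  because \<open>g\<close> is convex. The preceding lemma thus applies to this gap in place of
  \<open>g\<close>.\<close>

lemma majorization_gap_young:
  fixes g :: "'a::euclidean_space \<Rightarrow> real"
  assumes L: "psd_operator L" and H: "psd_operator H"
    and lower: "\<And>u v. 1/2 * sqnorm_wrt L (u - v) \<le> g u - g v - g' v \<bullet> (u - v)"
    and upper: "\<And>u v. g u - g v - g' v \<bullet> (u - v) \<le> 1/2 * sqnorm_wrt H (u - v)"
  shows "(H (u - v) - (g' u - g' v)) \<bullet> w \<le> 1/2 * sqnorm_wrt H (u - v) + 1/2 * sqnorm_wrt H w"
proof -
  have lin: "linear H" using H by (simp add: psd_operator_def)
  define \<phi> where "\<phi> = (\<lambda>u. 1/2 * sqnorm_wrt H u - g u)"
  define \<phi>' where "\<phi>' = (\<lambda>u. H u - g' u)"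
  have gap: "\<phi> u - \<phi> v - \<phi>' v \<bullet> (u - v) = 1/2 * sqnorm_wrt H (u - v) - (g u - g v - g' v \<bullet> (u - v))" for u v
    using psd_operator_symmetric[OF H, of u v]
    by (simp add: \<phi>_def \<phi>'_def sqnorm_wrt_def linear_diff[OF lin] inner_diff_left inner_diff_right inner_commute)
  have "(\<phi>' u - \<phi>' v) \<bullet> w \<le> 1/2 * sqnorm_wrt H (u - v) + 1/2 * sqnorm_wrt H w"
  proof (rule gradient_difference_young[OF _ _ lin])
    show "0 \<le> \<phi> u - \<phi> v - \<phi>' v \<bullet> (u - v)" for u v unfolding gap using upper[of u v] by simp
    show "\<phi> u - \<phi> v - \<phi>' v \<bullet> (u - v) \<le> 1/2 * sqnorm_wrt H (u - v)" for u v
      unfolding gap using lower[of u v] sqnorm_wrt_nonneg[OF L, of "u - v"] by simp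
  qed
  then show ?thesis by (simp add: \<phi>'_def linear_diff[OF lin] algebra_simps)
qed

text \<open>Serves both blocks; \<open>w\<close> is the multiplier predicted by the subproblem. The
  step in \<open>H\<close> that the three-point identity produces cancels the loss in
  \<open>majorized_gradient_lower\<close>, so only \<open>S\<close> and \<open>L\<close> remain on
  the step.\<close>

lemma majorized_block_step:
  fixes f :: "'a::euclidean_space \<Rightarrow> real" and A :: "'z::euclidean_space \<Rightarrow> 'a"
  assumes p: "proper_convex p" and A: "linear A"
    and L: "psd_operator L" and H: "psd_operator H" and S: "psd_operator S"
    and lower: "\<And>u v. 1/2 * sqnorm_wrt L (u - v) \<le> f u - f v - f' v \<bullet> (u - v)"
    and upper: "\<And>u v. f u - f v - f' v \<bullet> (u - v) \<le> 1/2 * sqnorm_wrt H (u - v)"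
    and s: "- f' s - A zs \<in> subdifferential p s"
    and v: "d - f' x - A w - (H (x' - x) + S (x' - x)) \<in> subdifferential p x'"
  shows "1/2 * (sqnorm_wrt (\<lambda>u. H u + S u) (x' - s) - sqnorm_wrt (\<lambda>u. H u + S u) (x - s))
      + 1/2 * sqnorm_wrt S (x' - x) + 1/4 * sqnorm_wrt L (x' - x)
      + (w - zs) \<bullet> adjoint A (x' - s) \<le> d \<bullet> (x' - s)"
proof -
  let ?P = "\<lambda>u. H u + S u"
  have "0 \<le> (d - f' x - A w - ?P (x' - x) - (- f' s - A zs)) \<bullet> (x' - s)"
    by (rule subdifferential_monotone[OF p v s])
  also have "\<dots> = d \<bullet> (x' - s) - (f' x - f' s) \<bullet> (x' - s) - (w - zs) \<bullet> adjoint A (x' - s)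
      - ?P (x' - x) \<bullet> (x' - s)"
    by (simp add: adjoint_works[OF A] linear_diff[OF A] inner_diff_left)
  also have "?P (x' - x) \<bullet> (x' - s) =
      1/2 * (sqnorm_wrt ?P (x' - s) - sqnorm_wrt ?P (x - s) + sqnorm_wrt ?P (x' - x))"
    using psd_three_point[OF psd_operator_add[OF H S], of "x' - s" "x - s"] by simp
  finally show ?thesis
    using majorized_gradient_lower[OF L lower upper, of x' x s] sqnorm_wrt_add[of H S "x' - x"] by argo
qed

text \<open>The new step occurs with full weight \<open>H + T\<close>. The mixed terms with the old
  step cost half of each square, which leaves half the new minus half the old: a telescoping
  difference.\<close>

lemma majorized_block_consecutive:
  fixes g :: "'a::euclidean_space \<Rightarrow> real" and B :: "'z::euclidean_space \<Rightarrow> 'a"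
  assumes q: "proper_convex q" and B: "linear B"
    and L: "psd_operator L" and H: "psd_operator H" and T: "psd_operator T"
    and lower: "\<And>u v. 1/2 * sqnorm_wrt L (u - v) \<le> g u - g v - g' v \<bullet> (u - v)"
    and upper: "\<And>u v. g u - g v - g' v \<bullet> (u - v) \<le> 1/2 * sqnorm_wrt H (u - v)"
    and v0: "d0 - g' y0 - B w0 - (H (y1 - y0) + T (y1 - y0)) \<in> subdifferential q y1"
    and v1: "d1 - g' y1 - B w1 - (H (y2 - y1) + T (y2 - y1)) \<in> subdifferential q y2"
  shows "(w1 - w0) \<bullet> adjoint B (y2 - y1)
      + 1/2 * (sqnorm_wrt (\<lambda>u. H u + T u) (y2 - y1) - sqnorm_wrt (\<lambda>u. H u + T u) (y1 - y0))
      \<le> (d1 - d0) \<bullet> (y2 - y1)"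
proof -
  have "0 \<le> (d1 - g' y1 - B w1 - (H (y2 - y1) + T (y2 - y1))
      - (d0 - g' y0 - B w0 - (H (y1 - y0) + T (y1 - y0)))) \<bullet> (y2 - y1)"
    by (rule subdifferential_monotone[OF q v1 v0])
  also have "\<dots> = (d1 - d0) \<bullet> (y2 - y1) - (w1 - w0) \<bullet> adjoint B (y2 - y1)
      - H (y2 - y1) \<bullet> (y2 - y1) - T (y2 - y1) \<bullet> (y2 - y1)
      + (H (y1 - y0) - (g' y1 - g' y0)) \<bullet> (y2 - y1) + T (y1 - y0) \<bullet> (y2 - y1)"
    unfolding adjoint_works[OF B] linear_diff[OF B] by (simp add: inner_diff_left inner_add_left)
  finally show ?thesis
    using majorization_gap_young[OF L H lower upper, of y1 y0 "y2 - y1"] psd_young[OF T, of "y1 - y0" "y2 - y1"]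
    unfolding sqnorm_wrt_def inner_add_right inner_commute[of "H (y2 - y1)"] inner_commute[of "T (y2 - y1)"]
    by argo
qed

lemma majorized_block_residual_bound:
  fixes A :: "'z::euclidean_space \<Rightarrow> 'a::euclidean_space" and P f' :: "'a \<Rightarrow> 'a"
  assumes A: "linear A" and P: "linear P" and lip: "\<exists>L. L-lipschitz_on UNIV f'"
  obtains K where "K \<ge> 0" "\<And>d x x' w z'. norm (d - f' x - A w - P (x' - x) + f' x' + A z')
    \<le> K * (norm d + norm (x' - x) + norm (w - z'))"
proof -
  obtain a where a: "a > 0" "\<And>u. norm (A u) \<le> a * norm u" using linear_bounded_pos[OF A] by blast
  obtain b where b: "b > 0" "\<And>u. norm (P u) \<le> b * norm u" using linear_bounded_pos[OF P] by blast
  obtain l where "l-lipschitz_on UNIV f'" using lip by blast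
  then have l: "l \<ge> 0" "\<And>u v. norm (f' u - f' v) \<le> l * norm (u - v)"
    by (auto simp: lipschitz_on_def dist_norm)
  define K where "K = 1 + a + b + l"
  show thesis
  proof (rule that[of K])
    show "K \<ge> 0" using a b l by (simp add: K_def)
    fix d x x' w z'
    have "norm (d - f' x - A w - P (x' - x) + f' x' + A z')
        = norm (d + (f' x' - f' x) - A (w - z') - P (x' - x))"
      by (simp add: linear_diff[OF A] algebra_simps)
    also have "\<dots> \<le> norm d + norm (f' x' - f' x) + norm (A (w - z')) + norm (P (x' - x))"
      by norm
    also have "\<dots> \<le> norm d + l * norm (x' - x) + a * norm (w - z') + b * norm (x' - x)"
      using a(2)[of "w - z'"] b(2)[of "x' - x"] l(2)[of x' x] by linarith
    also have "\<dots> \<le> K * norm d + K * norm (x' - x) + K * norm (w - z')"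
    proof -
      have "norm d \<le> K * norm d" using a b l by (simp add: K_def mult_le_cancel_right1)
      moreover have "(l + b) * norm (x' - x) \<le> K * norm (x' - x)" "a * norm (w - z') \<le> K * norm (w - z')"
        using a b l by (auto simp: K_def intro!: mult_right_mono)
      ultimately show ?thesis by (simp add: algebra_simps)
    qed
    finally show "norm (d - f' x - A w - P (x' - x) + f' x' + A z')
      \<le> K * (norm d + norm (x' - x) + norm (w - z'))" by (simp add: algebra_simps)
  qed
qed

subsection \<open>Summability and rates\<close>

lemma descent_summable:
  fixes \<Phi> a e :: "nat \<Rightarrow> real"
  assumes desc: "\<And>k. \<Phi> (Suc k) + a k \<le> \<Phi> k + e k" and \<Phi>: "\<And>k. 0 \<le> \<Phi> k" and a: "\<And>k. 0 \<le> a k"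
    and e: "summable e"
  shows "summable a"
proof -
  have part: "\<Phi> n + (\<Sum>k<n. a k) \<le> \<Phi> 0 + (\<Sum>k<n. e k)" for n
    by (induction n) (use desc in \<open>auto intro: order_trans[OF _ add_mono] simp: algebra_simps, smt (verit)\<close>)
  obtain C where C: "\<And>n. norm (\<Sum>k<n. e k) \<le> C"
    using convergent_imp_Bseq[OF summable_iff_convergent[THEN iffD1, OF e]] by (auto simp: Bseq_def)
  show ?thesis
  proof (rule bounded_imp_summable[where B = "\<Phi> 0 + C"])
    show "0 \<le> a k" for k by (rule a)
    show "sum a {..n} \<le> \<Phi> 0 + C" for n
      using part[of "Suc n"] C[of "Suc n"] \<Phi>[of "Suc n"] by (simp add: lessThan_Suc_atMost)
  qed
qed

text \<open>Since \<open>min\<^bsub>i \<le> k\<^esub> D\<^sub>i\<close> decreases in \<open>k\<close>, it is at most the average of the \<open>D\<^sub>i\<close> over the second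
  half of \<open>{1..k}\<close>, and these tails of the series tend to \<open>0\<close>.\<close>

lemma min_summable_rate:
  fixes D :: "nat \<Rightarrow> ereal" and a :: "nat \<Rightarrow> real"
  assumes D0: "\<And>i. 0 \<le> D i" and Da: "\<And>i. 1 \<le> i \<Longrightarrow> D i \<le> ereal (a i)" and a: "summable a" "\<And>i. 0 \<le> a i"
  shows "\<exists>\<omega>>0. \<forall>k\<ge>1. (MIN i\<in>{1..k}. D i) \<le> ereal (\<omega> / real k)"
    and "(\<lambda>k. ereal (real k) * (MIN i\<in>{1..k}. D i)) \<longlonglongrightarrow> 0"
proof -
  \<comment> \<open>\<open>D\<close> may take the value infinity, but its minimum over a nonempty
    range is finite. At \<open>k = 0\<close> the minimum is over the empty set, so every fact about
    \<open>\<mu>\<close> is stated for \<open>k \<ge> 1\<close>.\<close>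
  define \<mu> where "\<mu> k = real_of_ereal (MIN i\<in>{1..k}. D i)" for k :: nat
  have \<mu>: "(MIN i\<in>{1..k}. D i) = ereal (\<mu> k) \<and> 0 \<le> \<mu> k \<and> (\<forall>i\<in>{1..k}. \<mu> k \<le> a i)" if k: "k \<ge> 1" for k
  proof -
    have "0 \<le> (MIN i\<in>{1..k}. D i)" using k D0 by (subst Min_ge_iff) auto
    moreover have le: "(MIN i\<in>{1..k}. D i) \<le> ereal (a i)" if "i \<in> {1..k}" for i
      using that Da[of i] by (intro order_trans[OF Min_le]) auto
    moreover have "(MIN i\<in>{1..k}. D i) \<noteq> \<infinity>" using le[of 1] k by auto
    ultimately have eq: "(MIN i\<in>{1..k}. D i) = ereal (\<mu> k)"
      unfolding \<mu>_def by (cases "MIN i\<in>{1..k}. D i") auto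
    show ?thesis using \<open>0 \<le> (MIN i\<in>{1..k}. D i)\<close> le unfolding eq by auto
  qed
  have upper: "real k * \<mu> k \<le> suminf a" if "k \<ge> 1" for k
  proof -
    have "real k * \<mu> k = (\<Sum>i\<in>{1..k}. \<mu> k)" by simp
    also have "\<dots> \<le> (\<Sum>i\<in>{1..k}. a i)" using \<mu>[OF that] by (intro sum_mono) auto
    also have "\<dots> \<le> suminf a" using a by (intro sum_le_suminf) auto
    finally show ?thesis .
  qed
  have s0: "0 \<le> suminf a" using a by (simp add: suminf_nonneg)
  have "(MIN i\<in>{1..k}. D i) \<le> ereal ((suminf a + 1) / real k)" if "k \<ge> 1" for k
    using upper[OF that] \<mu>[OF that] that by (simp add: field_simps)
  then show "\<exists>\<omega>>0. \<forall>k\<ge>1. (MIN i\<in>{1..k}. D i) \<le> ereal (\<omega> / real k)"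
    using s0 by (intro exI[of _ "suminf a + 1"]) auto
  define s where "s n = (\<Sum>i<n. a i)" for n
  have s: "s \<longlonglongrightarrow> suminf a" unfolding s_def using a(1) by (rule summable_LIMSEQ)
  have half: "real k * \<mu> k \<le> 2 * (s (Suc k) - s (Suc (k div 2)))" if "k \<ge> 1" for k
  proof -
    have "real k * \<mu> k \<le> 2 * (real (k - k div 2) * \<mu> k)"
    proof -
      have "k \<le> 2 * (k - k div 2)" by simp
      then have "real k \<le> 2 * real (k - k div 2)" by linarith
      then have "real k * \<mu> k \<le> 2 * real (k - k div 2) * \<mu> k" using \<mu>[OF that] by (intro mult_right_mono) auto
      then show ?thesis by (simp only: mult.assoc)
    qed
    also have "real (k - k div 2) * \<mu> k = (\<Sum>i\<in>{Suc (k div 2)..<Suc k}. \<mu> k)" by simp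
    also have "\<dots> \<le> (\<Sum>i\<in>{Suc (k div 2)..<Suc k}. a i)" using \<mu>[OF that] by (intro sum_mono) auto
    also have "\<dots> = s (Suc k) - s (Suc (k div 2))"
      using sum_diff_nat_ivl[of 0 "Suc (k div 2)" "Suc k" a] by (simp add: s_def atLeast0LessThan)
    finally show ?thesis by simp
  qed
  have "filterlim (\<lambda>k::nat. Suc (k div 2)) at_top sequentially"
    unfolding filterlim_at_top
  proof
    show "\<forall>\<^sub>F k in sequentially. N \<le> Suc (k div 2)" for N
      by (rule eventually_sequentiallyI[of "2 * N"]) linarith
  qed
  then have "(\<lambda>k. 2 * (s (Suc k) - s (Suc (k div 2)))) \<longlonglongrightarrow> 2 * (suminf a - suminf a)"
    by (intro tendsto_intros filterlim_compose[OF s] filterlim_Suc)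
  then have "(\<lambda>k. 2 * (s (Suc k) - s (Suc (k div 2)))) \<longlonglongrightarrow> 0" by simp
  then have "(\<lambda>k. real k * \<mu> k) \<longlonglongrightarrow> 0"
    by (rule Lim_null_comparison[rotated])
      (use half \<mu> in \<open>auto simp: abs_mult intro!: eventually_sequentiallyI[of 1]\<close>)
  then have "(\<lambda>k. ereal (real k * \<mu> k)) \<longlonglongrightarrow> ereal 0" by simp
  moreover have "eventually (\<lambda>k. ereal (real k * \<mu> k) = ereal (real k) * (MIN i\<in>{1..k}. D i)) sequentially"
    using \<mu> by (intro eventually_sequentiallyI[of 1]) auto
  ultimately show "(\<lambda>k. ereal (real k) * (MIN i\<in>{1..k}. D i)) \<longlonglongrightarrow> 0"
    unfolding zero_ereal_def by (rule Lim_transform_eventually)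
qed

lemma edist_to_nonneg: "0 \<le> edist_to u U"
  unfolding edist_to_def by (intro INF_greatest) simp

lemma square_edist_to_le:
  assumes "u \<in> U" shows "(edist_to 0 U)\<^sup>2 \<le> ereal ((norm u)\<^sup>2)"
proof -
  have le: "edist_to 0 U \<le> ereal (norm u)" unfolding edist_to_def using assms by (intro INF_lower2) auto
  have "(edist_to 0 U)\<^sup>2 \<le> ereal (norm u) * ereal (norm u)"
    unfolding power2_eq_square using le edist_to_nonneg by (intro ereal_mult_mono) auto
  then show ?thesis by (simp add: power2_eq_square)
qed

subsection \<open>Descent along the iteration\<close>

text \<open>\<open>a\<close> is the Young weight: the first inequality keeps the coefficient of the
  \<open>B\<close>-step positive, the second that of the constraint residual. Both can hold exactly
  when \<open>(1 - \<tau>)\<^sup>2 < 2 - \<tau>\<close>, that is, when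
  \<open>(2 * \<tau> - 1)\<^sup>2 < 5\<close>.\<close>

lemma relaxation_weight:
  fixes \<tau> :: real
  assumes "0 < \<tau>" "\<tau> < (1 + sqrt 5) / 2"
  obtains a where "a > \<bar>1 - \<tau>\<bar>" "\<bar>1 - \<tau>\<bar> * a < 2 - \<tau>"
proof -
  have "(2 * \<tau> - 1)\<^sup>2 < 5"
  proof (cases "2 * \<tau> \<ge> 1")
    case True
    then have "(2 * \<tau> - 1)\<^sup>2 < (sqrt 5)\<^sup>2" using assms by (intro power_strict_mono) auto
    then show ?thesis by simp
  next
    case False
    then have "(1 - 2 * \<tau>)\<^sup>2 < 1\<^sup>2" using assms by (intro power_strict_mono) auto
    then show ?thesis by (simp add: power2_commute)
  qed
  then have g: "\<bar>1 - \<tau>\<bar> * \<bar>1 - \<tau>\<bar> < 2 - \<tau>" by (simp add: power2_eq_square algebra_simps)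
  \<comment> \<open>With weight \<open>\<bar>1 - \<tau>\<bar> + d\<close> the second condition asks
    that \<open>\<bar>1 - \<tau>\<bar> * d\<close> be less than the available slack. The added 1 in
    the denominator makes this strict and covers \<open>\<tau> = 1\<close>.\<close>
  define d where "d = (2 - \<tau> - \<bar>1 - \<tau>\<bar> * \<bar>1 - \<tau>\<bar>) / (\<bar>1 - \<tau>\<bar> + 1)"
  have d: "d > 0" "d * (\<bar>1 - \<tau>\<bar> + 1) = 2 - \<tau> - \<bar>1 - \<tau>\<bar> * \<bar>1 - \<tau>\<bar>" using g by (auto simp: d_def)
  show thesis by (rule that[of "\<bar>1 - \<tau>\<bar> + d"]) (use d in \<open>auto simp: algebra_simps\<close>)
qed

text \<open>The multiplier terms of one iteration. Here \<open>a\<close>, \<open>b\<close>, \<open>b0\<close> stand for \<open>A\<^sup>* (x\<^bsub>k+1\<^esub> - x)\<close>,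
  \<open>B\<^sup>* (y\<^bsub>k+1\<^esub> - y)\<close>, \<open>B\<^sup>* (y\<^bsub>k\<^esub> - y)\<close> at a KKT point \<open>(x, y, z)\<close>, and \<open>e\<close> for \<open>z\<^bsub>k\<^esub> - z\<close>.\<close>

lemma multiplier_identity:
  fixes a b b0 e :: "'z::real_inner"
  assumes "\<sigma> > 0" "\<tau> > 0"
  shows "(e + \<sigma> *\<^sub>R (a + b - (b - b0))) \<bullet> a + (e + \<sigma> *\<^sub>R (a + b)) \<bullet> b =
    1 / (2 * \<tau> * \<sigma>) * ((norm (e + (\<tau> * \<sigma>) *\<^sub>R (a + b)))\<^sup>2 - (norm e)\<^sup>2)
    + \<sigma> * (1 - \<tau> / 2) * (norm (a + b))\<^sup>2 - \<sigma> * ((b - b0) \<bullet> (a + b))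
    + \<sigma> / 2 * ((norm b)\<^sup>2 - (norm b0)\<^sup>2 + (norm (b - b0))\<^sup>2)"
proof -
  have "(norm (e + t *\<^sub>R w))\<^sup>2 - (norm e)\<^sup>2 = 2 * t * (e \<bullet> w + t / 2 * (norm w)\<^sup>2)" for t w
    unfolding power2_norm_eq_inner by (simp add: inner_add_left inner_add_right inner_commute algebra_simps)
  from this[of "\<tau> * \<sigma>" "a + b"] have "1 / (2 * \<tau> * \<sigma>) * ((norm (e + (\<tau> * \<sigma>) *\<^sub>R (a + b)))\<^sup>2 - (norm e)\<^sup>2)
      = e \<bullet> (a + b) + \<tau> * \<sigma> / 2 * (norm (a + b))\<^sup>2"
    using assms by simp
  then show ?thesis
    by (simp add: power2_norm_eq_inner inner_add_left inner_add_right inner_diff_left inner_diff_right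
        inner_commute algebra_simps)
qed

lemma cross_term_young:
  fixes r \<delta> :: "'z::real_inner"
  assumes "a > \<bar>\<theta>\<bar>"
  shows "\<theta> * (r \<bullet> \<delta>) \<le> \<bar>\<theta>\<bar> * a / 2 * (norm r)\<^sup>2 + \<bar>\<theta>\<bar> / (2 * a) * (norm \<delta>)\<^sup>2"
proof -
  have a: "a > 0" using assms by linarith
  have "\<theta> * (r \<bullet> \<delta>) \<le> \<bar>\<theta>\<bar> * (norm r * norm \<delta>)"
    using Cauchy_Schwarz_ineq2[of r \<delta>] by (metis abs_ge_self abs_mult abs_ge_zero mult_left_mono order_trans)
  also have "norm r * norm \<delta> \<le> a / 2 * (norm r)\<^sup>2 + 1 / (2 * a) * (norm \<delta>)\<^sup>2"
  proof -
    have "0 \<le> (a * norm r - norm \<delta>)\<^sup>2" by simp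
    then show ?thesis using a by (simp add: power2_eq_square field_simps)
  qed
  finally have "\<theta> * (r \<bullet> \<delta>) \<le> \<bar>\<theta>\<bar> * (a / 2 * (norm r)\<^sup>2 + 1 / (2 * a) * (norm \<delta>)\<^sup>2)"
    by (simp add: mult_left_mono)
  then show ?thesis by (simp add: algebra_simps)
qed

lemma square_sum3_le: "(a + b + c)\<^sup>2 \<le> 3 * (a\<^sup>2 + b\<^sup>2 + c\<^sup>2)" for a b c :: real
proof -
  have "0 \<le> (a - b)\<^sup>2 + (b - c)\<^sup>2 + (a - c)\<^sup>2" by simp
  then show ?thesis by (simp add: power2_eq_square algebra_simps)
qed

text \<open>\<open>Lf\<close>, \<open>Lg\<close> are the minorization and \<open>Hf\<close>, \<open>Hg\<close> the majorization operators, \<open>dx\<close> and \<open>dy\<close>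
  the errors in the subproblems.\<close>

locale padmm_run =
  fixes p :: "'x::euclidean_space \<Rightarrow> ereal" and q :: "'y::euclidean_space \<Rightarrow> ereal"
    and f :: "'x \<Rightarrow> real" and f' :: "'x \<Rightarrow> 'x" and g :: "'y \<Rightarrow> real" and g' :: "'y \<Rightarrow> 'y"
    and A :: "'z::euclidean_space \<Rightarrow> 'x" and B :: "'z \<Rightarrow> 'y" and c :: 'z
    and Lf Hf S :: "'x \<Rightarrow> 'x" and Lg Hg T :: "'y \<Rightarrow> 'y"
    and \<sigma> \<tau> :: real and \<epsilon> :: "nat \<Rightarrow> real"
    and x dx :: "nat \<Rightarrow> 'x" and y dy :: "nat \<Rightarrow> 'y" and z :: "nat \<Rightarrow> 'z"
    and xs :: 'x and ys :: 'y and zs :: 'z and C :: real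
  assumes p: "proper_convex p" and q: "proper_convex q" and A: "linear A" and B: "linear B"
    and Lf: "psd_operator Lf" and Hf: "psd_operator Hf" and S: "psd_operator S"
    and Lg: "psd_operator Lg" and Hg: "psd_operator Hg" and T: "psd_operator T"
    and f_lower: "\<And>u v. 1/2 * sqnorm_wrt Lf (u - v) \<le> f u - f v - f' v \<bullet> (u - v)"
    and f_upper: "\<And>u v. f u - f v - f' v \<bullet> (u - v) \<le> 1/2 * sqnorm_wrt Hf (u - v)"
    and g_lower: "\<And>u v. 1/2 * sqnorm_wrt Lg (u - v) \<le> g u - g v - g' v \<bullet> (u - v)"
    and g_upper: "\<And>u v. g u - g v - g' v \<bullet> (u - v) \<le> 1/2 * sqnorm_wrt Hg (u - v)"
    and f_lip: "\<exists>L. L-lipschitz_on UNIV f'" and g_lip: "\<exists>L. L-lipschitz_on UNIV g'"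
    and \<sigma>: "\<sigma> > 0" and \<tau>: "0 < \<tau>" "\<tau> < (1 + sqrt 5) / 2"
    and \<epsilon>: "\<And>k. 0 \<le> \<epsilon> k" "summable \<epsilon>"
    and pdx: "pd_operator (augmented_operator Lf S \<sigma> A)" and pdy: "pd_operator (augmented_operator Lg T \<sigma> B)"
    and kkt_x: "- f' xs - A zs \<in> subdifferential p xs" and kkt_y: "- g' ys - B zs \<in> subdifferential q ys"
    and kkt_z: "adjoint A xs + adjoint B ys = c"
    and step_x: "\<And>k. dx k - f' (x k) - A (z k + \<sigma> *\<^sub>R (adjoint A (x (Suc k)) + adjoint B (y k) - c))
        - (Hf (x (Suc k) - x k) + S (x (Suc k) - x k)) \<in> subdifferential p (x (Suc k))"
    and step_y: "\<And>k. dy k - g' (y k) - B (z k + \<sigma> *\<^sub>R (adjoint A (x (Suc k)) + adjoint B (y (Suc k)) - c))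
        - (Hg (y (Suc k) - y k) + T (y (Suc k) - y k)) \<in> subdifferential q (y (Suc k))"
    and step_z: "\<And>k. z (Suc k) = z k + (\<tau> * \<sigma>) *\<^sub>R (adjoint A (x (Suc k)) + adjoint B (y (Suc k)) - c)"
    and dx: "\<And>k. norm (dx k) \<le> C * \<epsilon> k" and dy: "\<And>k. norm (dy k) \<le> C * \<epsilon> k"
    and bound_x: "\<And>k. norm (x k - xs) \<le> C" and bound_y: "\<And>k. norm (y k - ys) \<le> C"
begin

definition r :: "nat \<Rightarrow> 'z" where "r k = adjoint A (x k) + adjoint B (y k) - c"

definition By :: "nat \<Rightarrow> 'z" where "By k = adjoint B (y (Suc k) - y k)"

abbreviation P :: "'x \<Rightarrow> 'x" where "P \<equiv> \<lambda>u. Hf u + S u"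
abbreviation Q :: "'y \<Rightarrow> 'y" where "Q \<equiv> \<lambda>u. Hg u + T u"

text \<open>The usual ADMM Lyapunov function at iterate \<open>k + 1\<close>, with two additions
  that pay for the cross term: the last y-step, which telescopes in the comparison of consecutive
  iterates, and the old constraint residual from Young's inequality.\<close>

definition potential :: "real \<Rightarrow> nat \<Rightarrow> real" where
  "potential a k = 1 / (2 * \<tau> * \<sigma>) * (norm (z (Suc k) - zs))\<^sup>2 + \<sigma> / 2 * (norm (adjoint B (y (Suc k) - ys)))\<^sup>2
    + 1/2 * sqnorm_wrt P (x (Suc k) - xs) + 1/2 * sqnorm_wrt Q (y (Suc k) - ys)
    + 1/2 * sqnorm_wrt Q (y (Suc k) - y k) + \<sigma> * (\<bar>1 - \<tau>\<bar> * a / 2) * (norm (r (Suc k)))\<^sup>2"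

definition decrease :: "real \<Rightarrow> nat \<Rightarrow> real" where
  "decrease a k = \<sigma> * ((2 - \<tau> - \<bar>1 - \<tau>\<bar> * a) / 2) * (norm (r (Suc (Suc k))))\<^sup>2
    + \<sigma> * ((1 - \<bar>1 - \<tau>\<bar> / a) / 2) * (norm (By (Suc k)))\<^sup>2
    + (1/2 * sqnorm_wrt S (x (Suc (Suc k)) - x (Suc k)) + 1/4 * sqnorm_wrt Lf (x (Suc (Suc k)) - x (Suc k)))
    + (1/2 * sqnorm_wrt T (y (Suc (Suc k)) - y (Suc k)) + 1/4 * sqnorm_wrt Lg (y (Suc (Suc k)) - y (Suc k)))"

definition err :: "nat \<Rightarrow> real" where
  "err k = dx (Suc k) \<bullet> (x (Suc (Suc k)) - xs) + dy (Suc k) \<bullet> (y (Suc (Suc k)) - ys)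
    + (dy (Suc k) - dy k) \<bullet> (y (Suc (Suc k)) - y (Suc k))"

lemma linear_adjoints: "linear (adjoint A)" "linear (adjoint B)"
  using A B by (auto intro: adjoint_linear)

lemma step_z_diff: "z (Suc k) - z k = (\<tau> * \<sigma>) *\<^sub>R r (Suc k)"
  using step_z[of k] by (simp add: r_def)

text \<open>The bad product of \<open>By (Suc k)\<close> and the new residual in the multiplier
  identity cancels against the same product in the comparison of consecutive y-iterates. Only
  \<open>1 - \<tau>\<close> times the product with the old residual is left; Young's inequality
  charges it to the potential and to the squared \<open>B\<close>-step.\<close>

lemma potential_descent:
  assumes a: "a > \<bar>1 - \<tau>\<bar>"
  shows "potential a (Suc k) + decrease a k \<le> potential a k + err k"
proof -
  let ?xo = "x (Suc k)" and ?xn = "x (Suc (Suc k))" and ?y = "y k" and ?yo = "y (Suc k)" and ?yn = "y (Suc (Suc k))"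
  let ?a = "adjoint A (?xn - xs)" and ?b = "adjoint B (?yn - ys)" and ?bo = "adjoint B (?yo - ys)"
  let ?e = "z (Suc k) - zs" and ?r = "r (Suc k)" and ?rn = "r (Suc (Suc k))" and ?d = "By (Suc k)"
  have "?rn = adjoint A ?xn + adjoint B ?yn - (adjoint A xs + adjoint B ys)"
    unfolding kkt_z r_def ..
  then have r1: "?rn = ?a + ?b"
    by (simp add: linear_diff[OF linear_adjoints(1)] linear_diff[OF linear_adjoints(2)])
  have d: "?d = ?b - ?bo"
    by (simp add: By_def linear_diff[OF linear_adjoints(2)])
  \<comment> \<open>The x-subproblem still sees the old \<open>y\<close>, so its residual lags
    behind the new one by the \<open>B\<close>-step.\<close>
  have s: "adjoint A ?xn + adjoint B ?yo - c = ?rn - ?d"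
    by (simp add: r_def By_def linear_diff[OF linear_adjoints(2)])
  have e1: "z (Suc (Suc k)) - zs = ?e + (\<tau> * \<sigma>) *\<^sub>R ?rn"
    using step_z_diff[of "Suc k"] by (simp add: algebra_simps)
  have 1: "1/2 * (sqnorm_wrt P (?xn - xs) - sqnorm_wrt P (?xo - xs))
      + 1/2 * sqnorm_wrt S (?xn - ?xo) + 1/4 * sqnorm_wrt Lf (?xn - ?xo)
      + (?e + \<sigma> *\<^sub>R (?rn - ?d)) \<bullet> ?a \<le> dx (Suc k) \<bullet> (?xn - xs)"
    using majorized_block_step[OF p A Lf Hf S f_lower f_upper kkt_x step_x, of "Suc k"]
    unfolding s by (simp add: algebra_simps)
  have 2: "1/2 * (sqnorm_wrt Q (?yn - ys) - sqnorm_wrt Q (?yo - ys))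
      + 1/2 * sqnorm_wrt T (?yn - ?yo) + 1/4 * sqnorm_wrt Lg (?yn - ?yo)
      + (?e + \<sigma> *\<^sub>R ?rn) \<bullet> ?b \<le> dy (Suc k) \<bullet> (?yn - ys)"
    using majorized_block_step[OF q B Lg Hg T g_lower g_upper kkt_y step_y, of "Suc k"]
    unfolding r_def by (simp add: algebra_simps)
  \<comment> \<open>Origin of \<open>1 - \<tau>\<close>: the multiplier moved by only
    \<open>\<tau> * \<sigma>\<close> times the residual, whereas the prediction uses the full
    \<open>\<sigma>\<close>.\<close>
  have "z (Suc k) + \<sigma> *\<^sub>R ?rn - (z k + \<sigma> *\<^sub>R ?r) = \<sigma> *\<^sub>R (?rn - (1 - \<tau>) *\<^sub>R ?r)"
    using step_z_diff[of k] by (simp add: algebra_simps)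
  then have 3: "(\<sigma> *\<^sub>R (?rn - (1 - \<tau>) *\<^sub>R ?r)) \<bullet> ?d
      + 1/2 * (sqnorm_wrt Q (?yn - ?yo) - sqnorm_wrt Q (?yo - ?y)) \<le> (dy (Suc k) - dy k) \<bullet> (?yn - ?yo)"
    using majorized_block_consecutive[OF q B Lg Hg T g_lower g_upper step_y[of k] step_y[of "Suc k"]]
    unfolding r_def By_def by simp
  have 4: "(?e + \<sigma> *\<^sub>R (?rn - ?d)) \<bullet> ?a + (?e + \<sigma> *\<^sub>R ?rn) \<bullet> ?b =
      1 / (2 * \<tau> * \<sigma>) * ((norm (z (Suc (Suc k)) - zs))\<^sup>2 - (norm ?e)\<^sup>2)
      + \<sigma> * (1 - \<tau> / 2) * (norm ?rn)\<^sup>2 - \<sigma> * (?d \<bullet> ?rn)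
      + \<sigma> / 2 * ((norm ?b)\<^sup>2 - (norm ?bo)\<^sup>2 + (norm ?d)\<^sup>2)"
    unfolding e1 r1 d by (rule multiplier_identity[OF \<sigma> \<tau>(1)])
  have 5: "(\<sigma> *\<^sub>R (?rn - (1 - \<tau>) *\<^sub>R ?r)) \<bullet> ?d = \<sigma> * (?d \<bullet> ?rn) - \<sigma> * ((1 - \<tau>) * (?r \<bullet> ?d))"
    by (simp add: inner_diff_left inner_commute algebra_simps)
  have 6: "\<sigma> * ((1 - \<tau>) * (?r \<bullet> ?d))
      \<le> \<sigma> * (\<bar>1 - \<tau>\<bar> * a / 2 * (norm ?r)\<^sup>2 + \<bar>1 - \<tau>\<bar> / (2 * a) * (norm ?d)\<^sup>2)"
    using cross_term_young[OF a] \<sigma> by (intro mult_left_mono) auto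
  \<comment> \<open>Each available square is split into the part kept as decrease and the part
    consumed: by the potential at the next index for the residual, by Young's inequality for the
    \<open>B\<close>-step.\<close>
  have 7: "\<sigma> * (1 - \<tau> / 2) * (norm ?rn)\<^sup>2 = \<sigma> * ((2 - \<tau> - \<bar>1 - \<tau>\<bar> * a) / 2) * (norm ?rn)\<^sup>2
      + \<sigma> * (\<bar>1 - \<tau>\<bar> * a / 2) * (norm ?rn)\<^sup>2"
    "\<sigma> / 2 * (norm ?d)\<^sup>2 = \<sigma> * ((1 - \<bar>1 - \<tau>\<bar> / a) / 2) * (norm ?d)\<^sup>2 + \<sigma> * (\<bar>1 - \<tau>\<bar> / (2 * a) * (norm ?d)\<^sup>2)"
    by (simp_all add: field_simps)
  show ?thesis
    using 1 2 3 4 5 6 7 unfolding potential_def decrease_def err_def right_diff_distrib distrib_left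
    by argo
qed

lemma potential_nonneg: "a > \<bar>1 - \<tau>\<bar> \<Longrightarrow> 0 \<le> potential a k"
  unfolding potential_def using \<sigma> \<tau>
  by (intro add_nonneg_nonneg mult_nonneg_nonneg sqnorm_wrt_nonneg psd_operator_add Hf S Hg T) auto

lemma summable_err_bound:
  obtains e where "summable e" "\<And>k. err k \<le> e k"
proof
  have C: "C \<ge> 0" using bound_x[of 0] norm_ge_zero order_trans by blast
  show "summable (\<lambda>k. C * \<epsilon> (Suc k) * C + C * \<epsilon> (Suc k) * C + (C * \<epsilon> (Suc k) + C * \<epsilon> k) * (2 * C))"
    using \<epsilon>(2) by (intro summable_add summable_mult summable_mult2) (auto simp: summable_Suc_iff)
  show "err k \<le> C * \<epsilon> (Suc k) * C + C * \<epsilon> (Suc k) * C + (C * \<epsilon> (Suc k) + C * \<epsilon> k) * (2 * C)" for k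
    unfolding err_def
  proof (intro add_mono)
    have i: "u \<bullet> v \<le> b * d" if "norm u \<le> b" "norm v \<le> d" for u v :: "'w::real_inner" and b d
    proof -
      have "u \<bullet> v \<le> norm u * norm v" by (rule norm_cauchy_schwarz)
      also have "\<dots> \<le> b * d" using that by (intro mult_mono) (auto intro: order_trans[OF norm_ge_zero])
      finally show ?thesis .
    qed
    show "dx (Suc k) \<bullet> (x (Suc (Suc k)) - xs) \<le> C * \<epsilon> (Suc k) * C" using dx bound_x by (rule i)
    show "dy (Suc k) \<bullet> (y (Suc (Suc k)) - ys) \<le> C * \<epsilon> (Suc k) * C" using dy bound_y by (rule i)
    show "(dy (Suc k) - dy k) \<bullet> (y (Suc (Suc k)) - y (Suc k)) \<le> (C * \<epsilon> (Suc k) + C * \<epsilon> k) * (2 * C)"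
    proof (rule i)
      show "norm (dy (Suc k) - dy k) \<le> C * \<epsilon> (Suc k) + C * \<epsilon> k"
        using dy[of k] dy[of "Suc k"] norm_triangle_ineq4[of "dy (Suc k)" "dy k"] by linarith
      show "norm (y (Suc (Suc k)) - y (Suc k)) \<le> 2 * C"
        using bound_y[of "Suc k"] bound_y[of "Suc (Suc k)"]
          norm_triangle_ineq4[of "y (Suc (Suc k)) - ys" "y (Suc k) - ys"] by simp
    qed
  qed
qed

text \<open>The decrease controls the steps only in seminorms. Adding the squared images under the
  adjoints completes these to the positive definite augmented minorization operators, which dominate
  the norm.\<close>

lemma summable_steps:
  shows "summable (\<lambda>k. (norm (r (Suc k)))\<^sup>2)" "summable (\<lambda>k. (norm (By k))\<^sup>2)"
    "summable (\<lambda>k. (norm (x (Suc k) - x k))\<^sup>2)" "summable (\<lambda>k. (norm (y (Suc k) - y k))\<^sup>2)"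
proof -
  obtain a where a: "a > \<bar>1 - \<tau>\<bar>" "\<bar>1 - \<tau>\<bar> * a < 2 - \<tau>" using relaxation_weight[OF \<tau>] .
  obtain e where e: "summable e" "\<And>k. err k \<le> e k" using summable_err_bound by blast
  have a0: "a > 0" using a(1) by linarith
  define k1 where "k1 = \<sigma> * ((2 - \<tau> - \<bar>1 - \<tau>\<bar> * a) / 2)"
  define k2 where "k2 = \<sigma> * ((1 - \<bar>1 - \<tau>\<bar> / a) / 2)"
  have k: "k1 > 0" "k2 > 0" using \<sigma> a a0 by (auto simp: k1_def k2_def)
  let ?X = "\<lambda>k. 1/2 * sqnorm_wrt S (x (Suc (Suc k)) - x (Suc k)) + 1/4 * sqnorm_wrt Lf (x (Suc (Suc k)) - x (Suc k))"
  let ?Y = "\<lambda>k. 1/2 * sqnorm_wrt T (y (Suc (Suc k)) - y (Suc k)) + 1/4 * sqnorm_wrt Lg (y (Suc (Suc k)) - y (Suc k))"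
  have dec: "decrease a k = k1 * (norm (r (Suc (Suc k))))\<^sup>2 + k2 * (norm (By (Suc k)))\<^sup>2 + ?X k + ?Y k" for k
    by (simp add: decrease_def k1_def k2_def)
  have X: "0 \<le> ?X k" and Y: "0 \<le> ?Y k" for k
    using sqnorm_wrt_nonneg[OF Lf] sqnorm_wrt_nonneg[OF S] sqnorm_wrt_nonneg[OF Lg] sqnorm_wrt_nonneg[OF T]
    by (auto intro!: add_nonneg_nonneg)
  have nn: "0 \<le> k1 * (norm (r (Suc (Suc k))))\<^sup>2" "0 \<le> k2 * (norm (By (Suc k)))\<^sup>2" for k
    using k by auto
  have sd: "summable (decrease a)"
  proof (rule descent_summable[of "potential a" _ e])
    show "potential a (Suc k) + decrease a k \<le> potential a k + e k" for k
      using potential_descent[OF a(1), of k] e(2)[of k] by linarith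
    show "0 \<le> decrease a k" for k using X[of k] Y[of k] nn[of k] unfolding dec by linarith
  qed (use potential_nonneg a e in auto)
  have s1: "summable (\<lambda>k. k1 * (norm (r (Suc (Suc k))))\<^sup>2)"
    by (rule summable_comparison_test'[OF sd, of 0]) (use X Y nn in \<open>simp add: dec add_increasing2 abs_of_nonneg\<close>)
  have s2: "summable (\<lambda>k. k2 * (norm (By (Suc k)))\<^sup>2)"
    by (rule summable_comparison_test'[OF sd, of 0]) (use X Y nn in \<open>simp add: dec add_increasing add_increasing2 abs_of_nonneg\<close>)
  have s3: "summable ?X"
    by (rule summable_comparison_test'[OF sd, of 0]) (use X Y nn in \<open>simp add: dec add_increasing add_increasing2 abs_of_nonneg\<close>)
  have s4: "summable ?Y"
    by (rule summable_comparison_test'[OF sd, of 0]) (use X Y nn in \<open>simp add: dec add_increasing add_increasing2 abs_of_nonneg\<close>)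
  have t1: "summable (\<lambda>k. (norm (r (Suc (Suc k))))\<^sup>2)" using summable_mult[OF s1, of "1 / k1"] k by simp
  then show r: "summable (\<lambda>k. (norm (r (Suc k)))\<^sup>2)" using summable_Suc_iff[of "\<lambda>k. (norm (r (Suc k)))\<^sup>2"] by simp
  have t2: "summable (\<lambda>k. (norm (By (Suc k)))\<^sup>2)" using summable_mult[OF s2, of "1 / k2"] k by simp
  then show "summable (\<lambda>k. (norm (By k))\<^sup>2)" using summable_Suc_iff[of "\<lambda>k. (norm (By k))\<^sup>2"] by simp
  have sq_aug: "sqnorm_wrt (augmented_operator L U \<sigma> D) u
      = sqnorm_wrt L u + sqnorm_wrt U u + \<sigma> * (norm (adjoint D u))\<^sup>2"
    if D: "linear D" for L U :: "'w::euclidean_space \<Rightarrow> 'w" and D :: "'z \<Rightarrow> 'w" and u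
    by (simp add: sqnorm_wrt_def augmented_operator_def inner_add_right power2_norm_eq_inner
        adjoint_works[OF D] inner_commute[of u])
  obtain cy where cy: "cy > 0" "\<And>u. (norm u)\<^sup>2 \<le> cy * sqnorm_wrt (augmented_operator Lg T \<sigma> B) u"
    using pd_operator_bounded_below[OF pdy] by blast
  have "summable (\<lambda>k. (norm (y (Suc (Suc k)) - y (Suc k)))\<^sup>2)"
  proof (rule summable_comparison_test'[where N = 0])
    \<comment> \<open>\<open>4 * ?Y k\<close> is twice the square in \<open>T\<close> plus the
      square in \<open>Lg\<close>, hence at least the part of the augmented operator without
      \<open>B\<close>.\<close>
    show "summable (\<lambda>k. cy * (4 * ?Y k + \<sigma> * (norm (By (Suc k)))\<^sup>2))"
      by (intro summable_mult[of _ cy] summable_add summable_mult[OF s4] summable_mult[OF t2])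
    show "norm ((norm (y (Suc (Suc k)) - y (Suc k)))\<^sup>2) \<le> cy * (4 * ?Y k + \<sigma> * (norm (By (Suc k)))\<^sup>2)" for k
    proof -
      have "(norm (y (Suc (Suc k)) - y (Suc k)))\<^sup>2
          \<le> cy * sqnorm_wrt (augmented_operator Lg T \<sigma> B) (y (Suc (Suc k)) - y (Suc k))" by (rule cy(2))
      also have "\<dots> \<le> cy * (4 * ?Y k + \<sigma> * (norm (By (Suc k)))\<^sup>2)"
        using cy(1) sqnorm_wrt_nonneg[OF T, of "y (Suc (Suc k)) - y (Suc k)"]
        by (intro mult_left_mono) (auto simp: sq_aug[OF B] By_def)
      finally show ?thesis by simp
    qed
  qed
  then show "summable (\<lambda>k. (norm (y (Suc k) - y k))\<^sup>2)"
    using summable_Suc_iff[of "\<lambda>k. (norm (y (Suc k) - y k))\<^sup>2"] by simp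
  obtain cx where cx: "cx > 0" "\<And>u. (norm u)\<^sup>2 \<le> cx * sqnorm_wrt (augmented_operator Lf S \<sigma> A) u"
    using pd_operator_bounded_below[OF pdx] by blast
  have "summable (\<lambda>k. (norm (x (Suc (Suc k)) - x (Suc k)))\<^sup>2)"
  proof (rule summable_comparison_test'[where N = 0])
    show "summable (\<lambda>k. cx * (4 * ?X k + \<sigma> * (3 * ((norm (r (Suc (Suc k))))\<^sup>2 + (norm (r (Suc k)))\<^sup>2 + (norm (By (Suc k)))\<^sup>2))))"
      by (intro summable_mult[of _ cx] summable_add[OF summable_mult[OF s3]] summable_mult[of _ \<sigma>]
          summable_mult[of _ 3] summable_add t1 r t2)
    show "norm ((norm (x (Suc (Suc k)) - x (Suc k)))\<^sup>2)
      \<le> cx * (4 * ?X k + \<sigma> * (3 * ((norm (r (Suc (Suc k))))\<^sup>2 + (norm (r (Suc k)))\<^sup>2 + (norm (By (Suc k)))\<^sup>2)))" for k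
    proof -
      \<comment> \<open>The decrease has no term for the image of the x-step under
        \<open>adjoint A\<close>; it is recovered from two consecutive residuals and the
        \<open>B\<close>-step.\<close>
      have eq: "adjoint A (x (Suc (Suc k)) - x (Suc k)) = r (Suc (Suc k)) - r (Suc k) - By (Suc k)"
        by (simp add: r_def By_def linear_diff[OF linear_adjoints(1)] linear_diff[OF linear_adjoints(2)])
      have "norm (r (Suc (Suc k)) - r (Suc k) - By (Suc k)) \<le> norm (r (Suc (Suc k))) + norm (r (Suc k)) + norm (By (Suc k))"
        by norm
      then have "(norm (r (Suc (Suc k)) - r (Suc k) - By (Suc k)))\<^sup>2
          \<le> (norm (r (Suc (Suc k))) + norm (r (Suc k)) + norm (By (Suc k)))\<^sup>2"
        by (intro power_mono) auto
      also have "\<dots> \<le> 3 * ((norm (r (Suc (Suc k))))\<^sup>2 + (norm (r (Suc k)))\<^sup>2 + (norm (By (Suc k)))\<^sup>2)"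
        by (rule square_sum3_le)
      finally have ad: "(norm (adjoint A (x (Suc (Suc k)) - x (Suc k))))\<^sup>2
          \<le> 3 * ((norm (r (Suc (Suc k))))\<^sup>2 + (norm (r (Suc k)))\<^sup>2 + (norm (By (Suc k)))\<^sup>2)"
        unfolding eq .
      have "(norm (x (Suc (Suc k)) - x (Suc k)))\<^sup>2
          \<le> cx * sqnorm_wrt (augmented_operator Lf S \<sigma> A) (x (Suc (Suc k)) - x (Suc k))" by (rule cx(2))
      also have "\<dots> \<le> cx * (4 * ?X k + \<sigma> * (3 * ((norm (r (Suc (Suc k))))\<^sup>2 + (norm (r (Suc k)))\<^sup>2 + (norm (By (Suc k)))\<^sup>2)))"
        unfolding sq_aug[OF A]
      proof (intro mult_left_mono add_mono ad)
        show "sqnorm_wrt Lf (x (Suc (Suc k)) - x (Suc k)) + sqnorm_wrt S (x (Suc (Suc k)) - x (Suc k)) \<le> 4 * ?X k"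
          using sqnorm_wrt_nonneg[OF S, of "x (Suc (Suc k)) - x (Suc k)"] by simp
      qed (use cx \<sigma> in auto)
      finally show ?thesis by simp
    qed
  qed
  then show "summable (\<lambda>k. (norm (x (Suc k) - x k))\<^sup>2)"
    using summable_Suc_iff[of "\<lambda>k. (norm (x (Suc k) - x k))\<^sup>2"] by simp
qed

section \<open>Summability of the KKT residual\<close>

lemma block_residual_summable:
  fixes D :: "'z \<Rightarrow> 'w::euclidean_space" and U h' :: "'w \<Rightarrow> 'w" and d v :: "nat \<Rightarrow> 'w"
  assumes D: "linear D" and U: "linear U" and lip: "\<exists>L. L-lipschitz_on UNIV h'"
    and d: "\<And>k. norm (d k) \<le> C * \<epsilon> k" and v: "summable (\<lambda>k. (norm (v (Suc k) - v k))\<^sup>2)"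
    and w: "summable (\<lambda>k. (norm (w k - z (Suc k)))\<^sup>2)"
  shows "summable (\<lambda>k. (norm (d k - h' (v k) - D (w k) - U (v (Suc k) - v k) + h' (v (Suc k)) + D (z (Suc k))))\<^sup>2)"
proof -
  obtain K where K: "K \<ge> 0" "\<And>d x x' w z'. norm (d - h' x - D w - U (x' - x) + h' x' + D z')
    \<le> K * (norm d + norm (x' - x) + norm (w - z'))"
    using majorized_block_residual_bound[OF D U lip] by blast
  \<comment> \<open>Squares of the tolerances are summable because the tolerances are eventually
    below 1.\<close>
  have "\<epsilon> \<longlonglongrightarrow> 0" using \<epsilon>(2) by (rule summable_LIMSEQ_zero)
  then obtain N where N: "\<And>k. k \<ge> N \<Longrightarrow> \<epsilon> k < 1"
    using order_tendstoD(2)[of \<epsilon> 0 sequentially 1] by (auto simp: eventually_sequentially)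
  have "summable (\<lambda>k. (\<epsilon> k)\<^sup>2)"
    by (rule summable_comparison_test'[OF \<epsilon>(2), of N])
      (simp add: power2_eq_square mult_left_le less_imp_le N \<epsilon>(1))
  then have s: "summable (\<lambda>k. K\<^sup>2 * (3 * (C\<^sup>2 * (\<epsilon> k)\<^sup>2 + (norm (v (Suc k) - v k))\<^sup>2 + (norm (w k - z (Suc k)))\<^sup>2)))"
    using v w by (intro summable_mult summable_add)
  show ?thesis
  proof (rule summable_comparison_test'[OF s, of 0])
    fix k
    let ?u = "d k - h' (v k) - D (w k) - U (v (Suc k) - v k) + h' (v (Suc k)) + D (z (Suc k))"
    have "norm ?u \<le> K * (norm (d k) + norm (v (Suc k) - v k) + norm (w k - z (Suc k)))" by (rule K(2))
    also have "\<dots> \<le> K * (C * \<epsilon> k + norm (v (Suc k) - v k) + norm (w k - z (Suc k)))"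
      using K(1) d[of k] by (intro mult_left_mono) auto
    finally have "(norm ?u)\<^sup>2 \<le> (K * (C * \<epsilon> k + norm (v (Suc k) - v k) + norm (w k - z (Suc k))))\<^sup>2"
      by (intro power_mono) auto
    also have "\<dots> = K\<^sup>2 * (C * \<epsilon> k + norm (v (Suc k) - v k) + norm (w k - z (Suc k)))\<^sup>2"
      by (simp add: power_mult_distrib)
    also have "\<dots> \<le> K\<^sup>2 * (3 * ((C * \<epsilon> k)\<^sup>2 + (norm (v (Suc k) - v k))\<^sup>2 + (norm (w k - z (Suc k)))\<^sup>2))"
      by (intro mult_left_mono square_sum3_le) auto
    finally show "norm ((norm ?u)\<^sup>2)
        \<le> K\<^sup>2 * (3 * (C\<^sup>2 * (\<epsilon> k)\<^sup>2 + (norm (v (Suc k) - v k))\<^sup>2 + (norm (w k - z (Suc k)))\<^sup>2))"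
      by (simp add: power_mult_distrib)
  qed
qed

text \<open>Each subproblem supplies an explicit element of the dual residual set, and the distance
  is at most its norm. That element consists of the error, the step, and the gap between predicted
  and actual multiplier.\<close>

lemma KKT_residual_summable:
  obtains a where "summable a" "\<And>k. 0 \<le> a k"
    "\<And>k. KKT_residual p q f' g' A B c (x (Suc k), y (Suc k), z (Suc k)) \<le> ereal (a k)"
proof -
  define wx where "wx = (\<lambda>k. z k + \<sigma> *\<^sub>R (adjoint A (x (Suc k)) + adjoint B (y k) - c))"
  define wy where "wy = (\<lambda>k. z k + \<sigma> *\<^sub>R (adjoint A (x (Suc k)) + adjoint B (y (Suc k)) - c))"
  define ux where "ux = (\<lambda>k. dx k - f' (x k) - A (wx k) - P (x (Suc k) - x k) + f' (x (Suc k)) + A (z (Suc k)))"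
  define uy where "uy = (\<lambda>k. dy k - g' (y k) - B (wy k) - Q (y (Suc k) - y k) + g' (y (Suc k)) + B (z (Suc k)))"
  note st = summable_steps
  \<comment> \<open>The y-prediction misses the new multiplier by a multiple of the residual alone;
    the x-prediction, made with the old \<open>y\<close>, also by the \<open>B\<close>-step.\<close>
  have wy: "wy k - z (Suc k) = (\<sigma> * (1 - \<tau>)) *\<^sub>R r (Suc k)" for k
    using step_z_diff[of k] by (simp add: wy_def r_def algebra_simps)
  have wx: "wx k - z (Suc k) = (\<sigma> * (1 - \<tau>)) *\<^sub>R r (Suc k) + (- \<sigma>) *\<^sub>R By k" for k
    unfolding wy[symmetric] by (simp add: wx_def wy_def By_def linear_diff[OF linear_adjoints(2)] algebra_simps)
  have swy: "summable (\<lambda>k. (norm (wy k - z (Suc k)))\<^sup>2)"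
    using st(1) by (simp add: wy power_mult_distrib)
  have swx: "summable (\<lambda>k. (norm (wx k - z (Suc k)))\<^sup>2)"
  proof (rule summable_comparison_test'[where N = 0])
    show "summable (\<lambda>k. 3 * ((\<sigma> * (1 - \<tau>))\<^sup>2 * (norm (r (Suc k)))\<^sup>2 + \<sigma>\<^sup>2 * (norm (By k))\<^sup>2 + 0\<^sup>2))"
      using st(1,2) by (intro summable_mult summable_add) auto
    fix k
    have "norm (wx k - z (Suc k)) \<le> norm ((\<sigma> * (1 - \<tau>)) *\<^sub>R r (Suc k)) + norm ((- \<sigma>) *\<^sub>R By k) + 0"
      unfolding wx add_0_right by (rule norm_triangle_ineq)
    then have "(norm (wx k - z (Suc k)))\<^sup>2 \<le> (norm ((\<sigma> * (1 - \<tau>)) *\<^sub>R r (Suc k)) + norm ((- \<sigma>) *\<^sub>R By k) + 0)\<^sup>2"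
      by (intro power_mono) auto
    also have "\<dots> \<le> 3 * ((norm ((\<sigma> * (1 - \<tau>)) *\<^sub>R r (Suc k)))\<^sup>2 + (norm ((- \<sigma>) *\<^sub>R By k))\<^sup>2 + 0\<^sup>2)"
      by (rule square_sum3_le)
    finally show "norm ((norm (wx k - z (Suc k)))\<^sup>2)
        \<le> 3 * ((\<sigma> * (1 - \<tau>))\<^sup>2 * (norm (r (Suc k)))\<^sup>2 + \<sigma>\<^sup>2 * (norm (By k))\<^sup>2 + 0\<^sup>2)"
      by (simp add: power_mult_distrib)
  qed
  have linPQ: "linear P" "linear Q"
    using psd_operator_add[OF Hf S] psd_operator_add[OF Hg T] by (auto simp: psd_operator_def)
  have sx: "summable (\<lambda>k. (norm (ux k))\<^sup>2)"
    unfolding ux_def by (rule block_residual_summable[OF A linPQ(1) f_lip dx st(3) swx])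
  have sy: "summable (\<lambda>k. (norm (uy k))\<^sup>2)"
    unfolding uy_def by (rule block_residual_summable[OF B linPQ(2) g_lip dy st(4) swy])
  show thesis
  proof (rule that[of "\<lambda>k. (norm (ux k))\<^sup>2 + (norm (uy k))\<^sup>2 + (norm (r (Suc k)))\<^sup>2"])
    show "summable (\<lambda>k. (norm (ux k))\<^sup>2 + (norm (uy k))\<^sup>2 + (norm (r (Suc k)))\<^sup>2)"
      using sx sy st(1) by (intro summable_add)
    fix k
    have ux: "ux k \<in> dual_residual_set p f' A (x (Suc k)) (z (Suc k))"
      using step_x[of k] by (auto simp: dual_residual_set_def ux_def wx_def)
    have uy: "uy k \<in> dual_residual_set q g' B (y (Suc k)) (z (Suc k))"
      using step_y[of k] by (auto simp: dual_residual_set_def uy_def wy_def)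
    have "KKT_residual p q f' g' A B c (x (Suc k), y (Suc k), z (Suc k))
      \<le> ereal ((norm (ux k))\<^sup>2) + ereal ((norm (uy k))\<^sup>2) + ereal ((norm (r (Suc k)))\<^sup>2)"
      unfolding KKT_residual_def prod.case r_def
      by (intro add_mono square_edist_to_le ux uy) simp
    then show "KKT_residual p q f' g' A B c (x (Suc k), y (Suc k), z (Suc k))
      \<le> ereal ((norm (ux k))\<^sup>2 + (norm (uy k))\<^sup>2 + (norm (r (Suc k)))\<^sup>2)" by simp
  qed simp
qed

end

section \<open>From the algorithm to the abstract run\<close>

lemma subproblem_optimality:
  fixes A :: "'z::euclidean_space \<Rightarrow> 'a::euclidean_space" and H S :: "'a \<Rightarrow> 'a"
  assumes p: "proper_convex p" and A: "linear A" and H: "psd_operator H" and S: "psd_operator S"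
    and M: "pd_operator (augmented_operator H S \<sigma> A)"
    and d: "d \<in> subdifferential (subproblem p (augmented_operator H S \<sigma> A)
      (- (h + A z - augmented_operator H S \<sigma> A x + \<sigma> *\<^sub>R A t))) x'"
    and t: "t + adjoint A (x' - x) = t'"
  shows "d - h - A (z + \<sigma> *\<^sub>R t') - (H (x' - x) + S (x' - x)) \<in> subdifferential p x'"
proof -
  let ?M = "augmented_operator H S \<sigma> A"
  have psdM: "psd_operator ?M" using M by (rule pd_operator_imp_psd)
  have lin: "linear ?M" using psdM by (simp add: psd_operator_def)
  have "d - ?M x' + (- (h + A z - ?M x + \<sigma> *\<^sub>R A t)) = d - h - A z - ?M (x' - x) - \<sigma> *\<^sub>R A t"
    by (simp add: linear_diff[OF lin] algebra_simps)
  \<comment> \<open>The part \<open>\<sigma> A A\<^sup>*\<close> of the augmented operator acting on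
    \<open>x' - x\<close> replaces the residual \<open>t\<close> before the block update by the
    residual \<open>t'\<close> after it, inside the multiplier.\<close>
  also have "\<dots> = d - h - A (z + \<sigma> *\<^sub>R t') - (H (x' - x) + S (x' - x))"
    by (simp add: augmented_operator_def linear_add[OF A] linear_scale[OF A] algebra_simps flip: t)
  finally show ?thesis
    by (rule subst[where P = "\<lambda>v. v \<in> subdifferential p x'"])
      (rule subdifferential_subproblem[OF p lin psd_operator_symmetric[OF psdM] d])
qed

lemma dual_residual_set_zero:
  "0 \<in> dual_residual_set p f' A x z \<longleftrightarrow> - f' x - A z \<in> subdifferential p x"
proof -
  have "0 = v + f' x + A z \<longleftrightarrow> v = - f' x - A z" for v
    by (auto simp: eq_diff_eq eq_neg_iff_add_eq_0 add_ac)
  then show ?thesis by (auto simp: dual_residual_set_def image_iff)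
qed

lemma convergent_bounded_difference:
  fixes x :: "nat \<Rightarrow> 'a::real_normed_vector"
  assumes "x \<longlonglongrightarrow> l"
  obtains K where "\<And>k. norm (x k - s) \<le> K"
  using convergent_imp_Bseq[OF convergentI[OF tendsto_diff[OF assms tendsto_const[of s]]]]
  by (auto simp: Bseq_def)

lemma KKT_residual_nonneg: "0 \<le> KKT_residual p q f' g' A B c w"
  by (cases w) (simp add: KKT_residual_def power2_eq_square edist_to_nonneg)

theorem theorem6p1:
  fixes m n :: nat
    and X :: "nat \<Rightarrow> 'x::euclidean_space set"
    and Y :: "nat \<Rightarrow> 'y::euclidean_space set"
    and p1 p :: "'x \<Rightarrow> ereal" and q1 q :: "'y \<Rightarrow> ereal"
    and f :: "'x \<Rightarrow> real" and f' :: "'x \<Rightarrow> 'x"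
    and g :: "'y \<Rightarrow> real" and g' :: "'y \<Rightarrow> 'y"
    and A :: "'z::euclidean_space \<Rightarrow> 'x" and B :: "'z \<Rightarrow> 'y" and c :: 'z
    and \<Sigma>f hat_\<Sigma>f S :: "'x \<Rightarrow> 'x" and \<Sigma>g hat_\<Sigma>g T :: "'y \<Rightarrow> 'y"
    and \<sigma> \<tau> :: real and \<epsilon> :: "nat \<Rightarrow> real"
    and x :: "nat \<Rightarrow> 'x" and y :: "nat \<Rightarrow> 'y" and z :: "nat \<Rightarrow> 'z"
    and x_lim :: 'x and y_lim :: 'y and z_lim :: 'z
  assumes "m \<ge> 1" and "n \<ge> 1"
    and "orthogonal_blocks m X" and "orthogonal_blocks n Y"
    and "closed_proper_convex_on (X 1) p1" and "closed_proper_convex_on (Y 1) q1"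
    and "p = (\<lambda>u. p1 (block_components m X u 1))"
    and "q = (\<lambda>v. q1 (block_components n Y v 1))"
    and "convex_on UNIV f" and "\<And>u. GDERIV f u :> f' u" and "continuous_on UNIV f'"
    and "\<exists>L. L-lipschitz_on UNIV f'"
    and "convex_on UNIV g" and "\<And>v. GDERIV g v :> g' v" and "continuous_on UNIV g'"
    and "\<exists>L. L-lipschitz_on UNIV g'"
    and "linear A" and "linear B"
    and "psd_operator \<Sigma>f" and "psd_operator hat_\<Sigma>f" and "loewner_le \<Sigma>f hat_\<Sigma>f"
    and "psd_operator \<Sigma>g" and "psd_operator hat_\<Sigma>g" and "loewner_le \<Sigma>g hat_\<Sigma>g"
    and "\<And>u u'. 1/2 * sqnorm_wrt \<Sigma>f (u - u') \<le> f u - f u' - f' u' \<bullet> (u - u')"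
    and "\<And>u u'. f u - f u' - f' u' \<bullet> (u - u') \<le> 1/2 * sqnorm_wrt hat_\<Sigma>f (u - u')"
    and "\<And>v v'. 1/2 * sqnorm_wrt \<Sigma>g (v - v') \<le> g v - g v' - g' v' \<bullet> (v - v')"
    and "\<And>v v'. g v - g v' - g' v' \<bullet> (v - v') \<le> 1/2 * sqnorm_wrt hat_\<Sigma>g (v - v')"
    and "\<sigma> > 0" and "0 < \<tau>" and "\<tau> < (1 + sqrt 5) / 2"
    and "\<And>k. \<epsilon> k \<ge> 0" and "summable \<epsilon>"
    and "psd_operator S" and "psd_operator T"
    and "pd_operator (augmented_operator hat_\<Sigma>f S \<sigma> A)"
    and "pd_operator (augmented_operator hat_\<Sigma>g T \<sigma> B)"
    and "imsPADMM_sequence p q f' g' A B c hat_\<Sigma>f hat_\<Sigma>g S T \<sigma> \<tau> \<epsilon> x y z"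
    and "KKT_solutions p q f' g' A B c \<noteq> {}"
    and "pd_operator (augmented_operator \<Sigma>f S \<sigma> A)"
    and "pd_operator (augmented_operator \<Sigma>g T \<sigma> B)"
    and "(\<lambda>k. (x k, y k, z k)) \<longlonglongrightarrow> (x_lim, y_lim, z_lim)"
  defines "D \<equiv> KKT_residual p q f' g' A B c"
  shows "(\<exists>\<omega>>0. \<forall>k\<ge>1. (MIN i\<in>{1..k}. D (x (Suc i), y (Suc i), z (Suc i))) \<le> ereal (\<omega> / real k)) \<and>
         (\<lambda>k. ereal (real k) * (MIN i\<in>{1..k}. D (x (Suc i), y (Suc i), z (Suc i)))) \<longlonglongrightarrow> 0"
proof -
  note a = assms
  let ?M = "augmented_operator hat_\<Sigma>f S \<sigma> A" and ?N = "augmented_operator hat_\<Sigma>g T \<sigma> B"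
  have pp: "proper_convex p" unfolding a(7)
    by (rule proper_convex_block[OF a(3) _ a(5)]) (use a(1) in auto)
  have qq: "proper_convex q" unfolding a(8)
    by (rule proper_convex_block[OF a(4) _ a(6)]) (use a(2) in auto)
  have run: "imsPADMM_sequence p q f' g' A B c hat_\<Sigma>f hat_\<Sigma>g S T \<sigma> \<tau> \<epsilon> x y z" by fact
  note A = \<open>linear A\<close> and B = \<open>linear B\<close>
  note pdM = \<open>pd_operator ?M\<close> and pdN = \<open>pd_operator ?N\<close>
  have "\<forall>k. \<exists>d. d \<in> subdifferential (subproblem p ?M (- (f' (x k) + A (z k) - ?M (x k)
        + \<sigma> *\<^sub>R A (adjoint A (x k) + adjoint B (y k) - c)))) (x (Suc k)) \<and>
      norm (inv (psd_sqrt ?M) d) \<le> \<epsilon> k"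
    using run by (simp add: imsPADMM_sequence_def Let_def)
  then obtain dx where dx: "\<And>k. dx k \<in> subdifferential (subproblem p ?M (- (f' (x k) + A (z k) - ?M (x k)
        + \<sigma> *\<^sub>R A (adjoint A (x k) + adjoint B (y k) - c)))) (x (Suc k))"
    and dxn: "\<And>k. norm (inv (psd_sqrt ?M) (dx k)) \<le> \<epsilon> k" by metis
  have "\<forall>k. \<exists>d. d \<in> subdifferential (subproblem q ?N (- (g' (y k) + B (z k) - ?N (y k)
        + \<sigma> *\<^sub>R B (adjoint A (x (Suc k)) + adjoint B (y k) - c)))) (y (Suc k)) \<and>
      norm (inv (psd_sqrt ?N) d) \<le> \<epsilon> k"
    using run by (simp add: imsPADMM_sequence_def Let_def)
  then obtain dy where dy: "\<And>k. dy k \<in> subdifferential (subproblem q ?N (- (g' (y k) + B (z k) - ?N (y k)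
        + \<sigma> *\<^sub>R B (adjoint A (x (Suc k)) + adjoint B (y k) - c)))) (y (Suc k))"
    and dyn: "\<And>k. norm (inv (psd_sqrt ?N) (dy k)) \<le> \<epsilon> k" by metis
  obtain xs ys zs where kkt: "(xs, ys, zs) \<in> KKT_solutions p q f' g' A B c"
    using \<open>KKT_solutions p q f' g' A B c \<noteq> {}\<close> by auto
  obtain Cx where Cx: "Cx > 0" "\<And>d. norm d \<le> Cx * norm (inv (psd_sqrt ?M) d)"
    using norm_le_inv_psd_sqrt[OF pdM] by blast
  obtain Cy where Cy: "Cy > 0" "\<And>d. norm d \<le> Cy * norm (inv (psd_sqrt ?N) d)"
    using norm_le_inv_psd_sqrt[OF pdN] by blast
  have lim: "(\<lambda>k. (x k, y k, z k)) \<longlonglongrightarrow> (x_lim, y_lim, z_lim)" by fact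
  have xlim: "x \<longlonglongrightarrow> x_lim" and ylim: "y \<longlonglongrightarrow> y_lim"
    using tendsto_fst[OF lim] tendsto_fst[OF tendsto_snd[OF lim]] by simp_all
  obtain Kx where Kx: "\<And>k. norm (x k - xs) \<le> Kx" using convergent_bounded_difference[OF xlim, of xs] by blast
  obtain Ky where Ky: "\<And>k. norm (y k - ys) \<le> Ky" using convergent_bounded_difference[OF ylim, of ys] by blast
  \<comment> \<open>A single constant bounds both the conversion of the tolerances and the distances
    of the iterates from the KKT point.\<close>
  define C where "C = max (max Cx Cy) (max Kx Ky)"
  have linadj: "linear (adjoint A)" "linear (adjoint B)" using A B by (auto intro: adjoint_linear)
  have eps: "\<epsilon> k \<ge> 0" for k by fact
  interpret padmm_run p q f f' g g' A B c \<Sigma>f hat_\<Sigma>f S \<Sigma>g hat_\<Sigma>g T \<sigma> \<tau> \<epsilon> x dx y dy z xs ys zs C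
  proof (intro padmm_run.intro)
    show "dx k - f' (x k) - A (z k + \<sigma> *\<^sub>R (adjoint A (x (Suc k)) + adjoint B (y k) - c))
        - (hat_\<Sigma>f (x (Suc k) - x k) + S (x (Suc k) - x k)) \<in> subdifferential p (x (Suc k))" for k
      by (rule subproblem_optimality[OF pp A _ _ pdM dx]) (use a in \<open>auto simp: linear_diff[OF linadj(1)]\<close>)
    show "dy k - g' (y k) - B (z k + \<sigma> *\<^sub>R (adjoint A (x (Suc k)) + adjoint B (y (Suc k)) - c))
        - (hat_\<Sigma>g (y (Suc k) - y k) + T (y (Suc k) - y k)) \<in> subdifferential q (y (Suc k))" for k
      by (rule subproblem_optimality[OF qq B _ _ pdN dy]) (use a in \<open>auto simp: linear_diff[OF linadj(2)]\<close>)
    show "z (Suc k) = z k + (\<tau> * \<sigma>) *\<^sub>R (adjoint A (x (Suc k)) + adjoint B (y (Suc k)) - c)" for k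
      using run by (simp add: imsPADMM_sequence_def Let_def)
    show "norm (dx k) \<le> C * \<epsilon> k" for k
    proof -
      have "norm (dx k) \<le> Cx * \<epsilon> k" using Cx dxn[of k] by (meson less_imp_le mult_left_mono order_trans)
      also have "\<dots> \<le> C * \<epsilon> k" using eps by (intro mult_right_mono) (auto simp: C_def)
      finally show ?thesis .
    qed
    show "norm (dy k) \<le> C * \<epsilon> k" for k
    proof -
      have "norm (dy k) \<le> Cy * \<epsilon> k" using Cy dyn[of k] by (meson less_imp_le mult_left_mono order_trans)
      also have "\<dots> \<le> C * \<epsilon> k" using eps by (intro mult_right_mono) (auto simp: C_def)
      finally show ?thesis .
    qed
    show "norm (x k - xs) \<le> C" "norm (y k - ys) \<le> C" for k
      using Kx[of k] Ky[of k] by (auto simp: C_def)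
    show "- f' xs - A zs \<in> subdifferential p xs" "- g' ys - B zs \<in> subdifferential q ys"
      "adjoint A xs + adjoint B ys = c"
      using kkt by (auto simp: KKT_solutions_def dual_residual_set_zero)
  qed (rule pp qq a(12,16-20,22,23,25-35,40,41))+
  obtain b where b: "summable b" "\<And>k. 0 \<le> b k"
    "\<And>k. D (x (Suc k), y (Suc k), z (Suc k)) \<le> ereal (b k)"
    unfolding D_def using KKT_residual_summable by blast
  have "0 \<le> D w" for w unfolding D_def by (rule KKT_residual_nonneg)
  then show ?thesis
    using min_summable_rate[of "\<lambda>i. D (x (Suc i), y (Suc i), z (Suc i))" b, OF _ b(3) b(1,2)] by simp
qed

end
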